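(* Let $d\ge3$. There exists $C\in\mathcal{C}^d_{ar}$ with the following properties: (1) $\mu_C$ is singular with respect to $\lambda_d$, has no point masses, and has full support $\mathbb{I}^d$; (2) for $\mu_{C^{1:d-1}}$-almost every $\mathbf{x}\in\mathbb{I}^{d-1}$ the conditional distribution function $y\mapsto K_C(\mathbf{x},[0,y])$ is continuous, strictly increasing and singular; (3) every level set $L_t=\{\mathbf{u}\in\mathbb{I}^d:C(\mathbf{u})=t\}$, $t\in\mathbb{I}$, satisfies $\mu_C(L_t)=0$; (4) the Kendall distribution function $F_K^d$ of $C$ is continuous, strictly increasing and singular.
   Context: $\mathbb{I}=[0,1]$. $\mathcal{C}^d_{ar}$ is the class of $d$-dimensional Archimedean copulas $C(\mathbf{u})=\psi(\sum_{i=1}^d\varphi(u_i))$, where $\psi:[0,\infty)\to\mathbb{I}$ is continuous, non-increasing, $\psi(0)=1$, $\lim_{z\to\infty}\psi(z)=0$, strictly decreasing on $[0,\inf\{z:\psi(z)=0\}]$, $\psi(1)=1/2$, with $(-1)^{d-2}\psi^{(d-2)}$ existing, non-negative, non-increasing and convex on $(0,\infty)$; $\varphi$ is the pseudo-inverse. $\mu_C$ is the measure of $C$; $C^{1:d-1}(\mathbf{x})=C(\mathbf{x},1)$; $K_C$ is the $(d-1)$-Markov kernel (regular conditional distribution of the last coordinate given the first $d-1$). A continuous distribution function is singular if its derivative is $0$ Lebesgue-a.e. $F_K^d(t)=\mu_C(\{\mathbf{u}:C(\mathbf{u})\le t\})$ is the Kendall distribution function. *)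

theory Defs
  imports "HOL-Probability.Probability"
begin

text \<open>Points of the unit cube I^d are represented as extensional functions
  nat => real on the index set {..<d}; coordinate d-1 is the last one.\<close>

abbreviation unit_cube :: "nat \<Rightarrow> (nat \<Rightarrow> real) set" where
  "unit_cube d \<equiv> PiE {..<d} (\<lambda>_. {0..1::real})"

definition arch_generator :: "nat \<Rightarrow> (real \<Rightarrow> real) \<Rightarrow> bool" where
  "arch_generator d \<psi> \<longleftrightarrow>
     continuous_on {0..} \<psi> \<and>
     \<psi> ` {0..} \<subseteq> {0..1} \<and>
     (\<forall>x y. 0 \<le> x \<and> x \<le> y \<longrightarrow> \<psi> y \<le> \<psi> x) \<and>
     \<psi> 0 = 1 \<and>
     (\<psi> \<longlongrightarrow> 0) at_top \<and>
     strict_antimono_on {z. 0 \<le> z \<and> (\<forall>w. 0 \<le> w \<and> \<psi> w = 0 \<longrightarrow> z \<le> w)} \<psi> \<and>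
     \<psi> 1 = 1/2 \<and>
     (\<exists>f :: nat \<Rightarrow> real \<Rightarrow> real.
        (\<forall>x>0. f 0 x = \<psi> x) \<and>
        (\<forall>k<d-2. \<forall>x>0. (f k has_real_derivative f (Suc k) x) (at x)) \<and>
        (\<forall>x>0. (-1) ^ (d-2) * f (d-2) x \<ge> 0) \<and>
        (\<forall>x y. 0 < x \<and> x \<le> y \<longrightarrow> (-1) ^ (d-2) * f (d-2) y \<le> (-1) ^ (d-2) * f (d-2) x) \<and>
        convex_on {0<..} (\<lambda>x. (-1) ^ (d-2) * f (d-2) x))"

definition pseudo_inv :: "(real \<Rightarrow> real) \<Rightarrow> real \<Rightarrow> real" where
  "pseudo_inv \<psi> t = Inf {z. 0 \<le> z \<and> \<psi> z \<le> t}"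

text \<open>The Archimedean copula C(u) = psi(sum phi(u_i)); on coordinates equal to 0
  the value is 0 (phi(0) is the zero of psi or infinity), and the function is
  extended outside I^d as a distribution function (clamping at 0 and 1).\<close>
definition arch_copula :: "nat \<Rightarrow> (real \<Rightarrow> real) \<Rightarrow> (nat \<Rightarrow> real) \<Rightarrow> real" where
  "arch_copula d \<psi> u =
     (if \<exists>i<d. u i \<le> 0 then 0 else \<psi> (\<Sum>i<d. pseudo_inv \<psi> (min (u i) 1)))"

definition copula_measure :: "nat \<Rightarrow> ((nat \<Rightarrow> real) \<Rightarrow> real) \<Rightarrow> (nat \<Rightarrow> real) measure \<Rightarrow> bool" where
  "copula_measure d C \<mu> \<longleftrightarrow>
     sets \<mu> = sets (PiM {..<d} (\<lambda>_. borel :: real measure)) \<and>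
     prob_space \<mu> \<and>
     emeasure \<mu> (unit_cube d) = 1 \<and>
     (\<forall>u \<in> unit_cube d. measure \<mu> (PiE {..<d} (\<lambda>i. {0..u i})) = C u)"

definition singular_wrt_lebesgue :: "nat \<Rightarrow> (nat \<Rightarrow> real) measure \<Rightarrow> bool" where
  "singular_wrt_lebesgue d \<mu> \<longleftrightarrow>
     (\<exists>N \<in> sets (PiM {..<d} (\<lambda>_. lborel)).
        emeasure (PiM {..<d} (\<lambda>_. lborel)) N = 0 \<and> emeasure \<mu> (space \<mu> - N) = 0)"

definition measure_support :: "nat \<Rightarrow> (nat \<Rightarrow> real) measure \<Rightarrow> (nat \<Rightarrow> real) set" where
  "measure_support d \<mu> =
     {x \<in> PiE {..<d} (\<lambda>_. UNIV). \<forall>e>0.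
        emeasure \<mu> (PiE {..<d} (\<lambda>i. {x i - e <..< x i + e})) > 0}"

definition first_marginal :: "nat \<Rightarrow> (nat \<Rightarrow> real) measure \<Rightarrow> (nat \<Rightarrow> real) measure" where
  "first_marginal d \<mu> =
     distr \<mu> (PiM {..<d-1} (\<lambda>_. borel :: real measure)) (\<lambda>u. restrict u {..<d-1})"

definition markov_kernel_of :: "nat \<Rightarrow> (nat \<Rightarrow> real) measure \<Rightarrow> ((nat \<Rightarrow> real) \<Rightarrow> real measure) \<Rightarrow> bool" where
  "markov_kernel_of d \<mu> K \<longleftrightarrow>
     (\<forall>x \<in> space (PiM {..<d-1} (\<lambda>_. borel :: real measure)).
        prob_space (K x) \<and> sets (K x) = sets (borel :: real measure)) \<and>
     (\<forall>B \<in> sets (borel :: real measure).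
        (\<lambda>x. emeasure (K x) B) \<in> borel_measurable (PiM {..<d-1} (\<lambda>_. borel :: real measure))) \<and>
     (\<forall>A \<in> sets (PiM {..<d-1} (\<lambda>_. borel :: real measure)). \<forall>B \<in> sets (borel :: real measure).
        emeasure \<mu> {u \<in> space \<mu>. restrict u {..<d-1} \<in> A \<and> u (d-1) \<in> B}
        = (\<integral>\<^sup>+ x. indicator A x * emeasure (K x) B \<partial>(first_marginal d \<mu>)))"

definition cont_strict_singular :: "(real \<Rightarrow> real) \<Rightarrow> bool" where
  "cont_strict_singular F \<longleftrightarrow>
     (\<forall>y. isCont F y) \<and> strict_mono_on {0..1} F \<and>
     (AE y in lborel. (F has_real_derivative 0) (at y))"

definition kendall_df :: "(nat \<Rightarrow> real) measure \<Rightarrow> ((nat \<Rightarrow> real) \<Rightarrow> real) \<Rightarrow> real \<Rightarrow> real" where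
  "kendall_df \<mu> C t = measure \<mu> {u \<in> space \<mu>. C u \<le> t}"

end

theory Submission
  imports Defs
begin

text \<open>Let \<nu> be a measure on the positive half-line which is singular, atomless, positive on every interval
  and has a finite moment of order m = d - 1. Draw (x, r) from the restriction of dx \<nu>(dr) to the set
  where all x i are nonnegative and have sum at most r, and put X i = x i for i < m and X m = r - sum x.
  Since a corner simplex of size s has volume s^m / m!, the survival function of X is \<psi>(z 0 + ... + z m) with
  \<psi>(z) = \<integral> max 0 (r - z)^m / m! \<nu>(dr), so U i = \<psi>(X i) has the Archimedean copula of \<psi> as its
  distribution function, and C(U) = \<psi>(r). Thus the Kendall distribution is the image of r^m / m! \<nu>(dr),
  and the conditional law of U m given the other coordinates, with s = sum x, is the image of the normalised
  restriction of \<nu> to [s, \<infinity>). As \<psi> is continuously differentiable and strictly decreasing, all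
  these laws inherit singularity, atomlessness and full support from \<nu>, and a singular finite measure
  has a distribution function with derivative 0 almost everywhere.\<close>

text \<open>The singularity is placed in the highest derivative: up to sign, the m-th derivative of
  \<psi> is the tail function of \<nu>. So \<psi> stays m times continuously differentiable, and the
  laws in question depend on r through such a map only. This is why \<nu> and not \<psi> is
  prescribed. Charging every interval of the half-line keeps \<psi> positive, so the pseudo-inverse
  is a true inverse on (0, 1]; the moment of order m makes \<psi>(0) finite; a dilation and a
  constant factor then achieve \<psi>(0) = 1 and \<psi>(1) = 1/2. Working with dx \<nu>(dr) on a
  wedge, rather than with a radius times a point of a simplex, makes both orders of integration
  available: integrating out x leaves statements about r, integrating out r leaves conditional laws.
  The delicate point of (2) is that it concerns every version of the kernel. An explicit kernel has
  the required properties at every point, and any other version agrees with it almost everywhere,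
  which has to be reduced to countably many half-lines.\<close>

section \<open>Distribution functions of singular measures\<close>

text \<open>A Vitali covering argument. By outer regularity the \<tau>-null set \<open>- N\<close>
  lies in an open \<open>U\<close> of mass below \<open>e * \<epsilon>\<close>. Short intervals
  inside \<open>U\<close> whose mass is at least \<epsilon> times their length cover the set finely;
  a disjoint subfamily covers almost all of it and has total length at most \<tau>(U)/\<epsilon>,
  hence at most e.\<close>

lemma singular_slope_set_negligible:
  fixes \<tau> :: "real measure" and \<epsilon> :: real
  assumes \<tau>: "sets \<tau> = sets borel" and fin: "finite_measure \<tau>"
    and N: "N \<in> sets borel" "emeasure \<tau> (- N) = 0" and \<epsilon>: "0 < \<epsilon>"
  shows "negligible {y. y \<notin> N \<and> (\<forall>\<delta>>0. \<exists>z. 0 < \<bar>z - y\<bar> \<and> \<bar>z - y\<bar> < \<delta> \<and>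
            \<epsilon> * \<bar>z - y\<bar> \<le> measure \<tau> {min y z..max y z})}" (is "negligible ?E")
  unfolding negligible_outer_le
proof (intro allI impI)
  fix e :: real assume e: "0 < e"
  interpret finite_measure \<tau> by (rule fin)
  have "emeasure \<tau> (- N) = (INF U\<in>{U. - N \<subseteq> U \<and> open U}. emeasure \<tau> U)"
    using N emeasure_finite by (intro outer_regular \<tau>) auto
  then have "(INF U\<in>{U. - N \<subseteq> U \<and> open U}. emeasure \<tau> U) < ennreal (e * \<epsilon>)"
    using N e \<epsilon> by simp
  then obtain U where U: "- N \<subseteq> U" "open U" "emeasure \<tau> U < ennreal (e * \<epsilon>)"
    by (auto simp: INF_less_iff)
  \<comment> \<open>Intervals are recorded as (centre, radius), the format of the covering theorem
    for balls; \<open>2 * r\<close> is the length.\<close>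
  define K where "K = {(a, r). 0 < r \<and> cball a r \<subseteq> U \<and> \<epsilon> * (2 * r) \<le> measure \<tau> (cball a r)}"
  have "\<exists>i. i \<in> K \<and> y \<in> cball (fst i) (snd i) \<and> snd i < d" if y: "y \<in> ?E" and d: "0 < d" for y d
  proof -
    have "y \<in> U" using y U by auto
    then obtain \<delta>0 where \<delta>0: "0 < \<delta>0" "ball y \<delta>0 \<subseteq> U" using U(2) openE by blast
    have "0 < min \<delta>0 d" using \<delta>0 d by simp
    then obtain z where z: "0 < \<bar>z - y\<bar>" "\<bar>z - y\<bar> < min \<delta>0 d"
      "\<epsilon> * \<bar>z - y\<bar> \<le> measure \<tau> {min y z..max y z}" using y by blast
    \<comment> \<open>\<open>y\<close> is an end point of the interval, as difference quotients
      require; the covering theorem asks only that the ball contain \<open>y\<close>.\<close>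
    define a r where "a = (y + z) / 2" and "r = \<bar>z - y\<bar> / 2"
    have I: "cball a r = {min y z..max y z}"
      unfolding cball_eq_atLeastAtMost a_def r_def
      by (cases "y \<le> z") (auto simp: field_simps)
    have "{min y z..max y z} \<subseteq> ball y \<delta>0"
      using z by (auto simp: dist_real_def)
    then have "(a, r) \<in> K"
      using z \<delta>0 unfolding K_def by (auto simp: I) (auto simp: r_def)
    moreover have "y \<in> cball a r" unfolding I by auto
    moreover have "r < d" using z by (auto simp: r_def)
    ultimately show ?thesis by (metis fst_conv snd_conv)
  qed
  moreover have "0 < snd i" if "i \<in> K" for i using that by (auto simp: K_def)
  ultimately obtain C where C: "countable C" "C \<subseteq> K"
     "pairwise (\<lambda>i j. disjnt (cball (fst i) (snd i)) (cball (fst j) (snd j))) C"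
     "negligible (?E - (\<Union>i\<in>C. cball (fst i) (snd i)))"
    using Vitali_covering_theorem_cballs[of K snd ?E fst] by blast
  let ?B = "\<lambda>i. cball (fst i) (snd i) :: real set"
  have disj: "disjoint_family_on ?B C"
    using C(3) by (auto simp: disjoint_family_on_def pairwise_def disjnt_def)
  have "emeasure lborel (\<Union>i\<in>C. ?B i) = (\<integral>\<^sup>+i. emeasure lborel (?B i) \<partial>count_space C)"
    using C disj by (intro emeasure_UN_countable) auto
  also have "\<dots> \<le> (\<integral>\<^sup>+i. ennreal (1/\<epsilon>) * emeasure \<tau> (?B i) \<partial>count_space C)"
  proof (intro nn_integral_mono)
    fix i assume "i \<in> space (count_space C)"
    then have "i \<in> K" using C by auto
    then have i: "0 < snd i" "\<epsilon> * (2 * snd i) \<le> measure \<tau> (?B i)" by (auto simp: K_def)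
    have "emeasure lborel (?B i) = ennreal (2 * snd i)"
      using i by (simp add: cball_eq_atLeastAtMost)
    also have "\<dots> \<le> ennreal (1/\<epsilon> * measure \<tau> (?B i))"
      using i \<epsilon> by (intro ennreal_leI) (simp add: field_simps)
    also have "\<dots> = ennreal (1/\<epsilon>) * emeasure \<tau> (?B i)"
      unfolding emeasure_eq_measure using \<epsilon> by (intro ennreal_mult) auto
    finally show "emeasure lborel (?B i) \<le> ennreal (1/\<epsilon>) * emeasure \<tau> (?B i)" .
  qed
  also have "\<dots> = ennreal (1/\<epsilon>) * (\<integral>\<^sup>+i. emeasure \<tau> (?B i) \<partial>count_space C)"
    by (intro nn_integral_cmult) auto
  also have "(\<integral>\<^sup>+i. emeasure \<tau> (?B i) \<partial>count_space C) = emeasure \<tau> (\<Union>i\<in>C. ?B i)"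
    using C disj by (intro emeasure_UN_countable[symmetric]) (auto simp: \<tau>)
  also have "\<dots> \<le> emeasure \<tau> U"
  proof (rule emeasure_mono)
    have "?B i \<subseteq> U" if "i \<in> C" for i
      using that C(2) unfolding K_def by (cases i) (force simp del: mem_cball)
    then show "(\<Union>i\<in>C. ?B i) \<subseteq> U" by blast
    show "U \<in> sets \<tau>" using U by (simp add: \<tau>)
  qed
  also have "ennreal (1/\<epsilon>) * emeasure \<tau> U \<le> ennreal (1/\<epsilon>) * ennreal (e * \<epsilon>)"
    using U by (intro mult_left_mono) auto
  also have "\<dots> = ennreal e"
    using e \<epsilon> by (simp add: ennreal_mult[symmetric])
  finally have le: "emeasure lborel (\<Union>i\<in>C. ?B i) \<le> ennreal e"
    by (simp add: mult_left_mono)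
  have meas: "(\<Union>i\<in>C. ?B i) \<in> sets borel"
    using C by (intro sets.countable_UN'') auto
  \<comment> \<open>The covered part plus the null remainder is a measurable superset, so
    measurability of the exceptional set itself is never at issue.\<close>
  define T where "T = (\<Union>i\<in>C. ?B i) \<union> (?E - (\<Union>i\<in>C. ?B i))"
  have n: "?E - (\<Union>i\<in>C. ?B i) \<in> null_sets lebesgue"
    using C(4) by (simp add: negligible_iff_null_sets)
  have "emeasure lebesgue T = emeasure lebesgue (\<Union>i\<in>C. ?B i)"
    unfolding T_def using meas n by (intro emeasure_Un_null_set) (auto intro: sets_completionI_sets)
  also have "\<dots> = emeasure lborel (\<Union>i\<in>C. ?B i)"
    using meas by simp
  finally have T: "emeasure lebesgue T \<le> ennreal e" using le by simp
  have "(\<Union>i\<in>C. ?B i) \<in> sets lebesgue" using meas by (intro sets_completionI_sets) simp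
  then have Ts: "T \<in> sets lebesgue" unfolding T_def using null_setsD2[OF n] by (rule sets.Un)
  have "T \<in> lmeasurable" using T Ts by (intro fmeasurableI) (auto intro: le_less_trans)
  moreover have "measure lebesgue T \<le> e"
    using T e unfolding measure_def by (intro enn2real_leI) auto
  moreover have "?E \<subseteq> T" unfolding T_def by blast
  ultimately show "\<exists>T. ?E \<subseteq> T \<and> T \<in> lmeasurable \<and> measure lebesgue T \<le> e" by blast
qed

text \<open>If the derivative is not 0 at a point outside \<open>N\<close>, then for some k there
  are difference quotients of size at least 1/(k+1) arbitrarily close to it. Increments are bounded
  by the mass of the closed interval between the two points, so the point lies in one of countably
  many negligible slope sets.\<close>

lemma singular_cdf_has_derivative_zero:
  fixes \<tau> :: "real measure"
  assumes \<tau>: "sets \<tau> = sets borel" and fin: "finite_measure \<tau>"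
    and N: "N \<in> sets borel" "emeasure lborel N = 0" "emeasure \<tau> (- N) = 0"
  shows "AE y in lborel. ((\<lambda>y. measure \<tau> {..y}) has_real_derivative 0) (at y)"
proof -
  interpret finite_measure \<tau> by (rule fin)
  define F where "F = (\<lambda>y. measure \<tau> {..y})"
  define E where "E n = {y. y \<notin> N \<and> (\<forall>\<delta>>0. \<exists>z. 0 < \<bar>z - y\<bar> \<and> \<bar>z - y\<bar> < \<delta> \<and>
      inverse (real (Suc n)) * \<bar>z - y\<bar> \<le> measure \<tau> {min y z..max y z})}" for n
  have "negligible N"
    using N by (simp add: negligible_iff_null_sets null_sets_def)
  moreover have "negligible (E n)" for n
    unfolding E_def by (rule singular_slope_set_negligible[OF \<tau> fin N(1,3)]) simp
  ultimately have neg: "negligible (N \<union> (\<Union>n. E n))"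
    by (intro negligible_Un negligible_countable_Union) auto
  have "{y. \<not> (F has_real_derivative 0) (at y)} \<subseteq> N \<union> (\<Union>n. E n)"
  proof (intro subsetI, rule ccontr)
    fix y assume y: "y \<in> {y. \<not> (F has_real_derivative 0) (at y)}" and n: "y \<notin> N \<union> (\<Union>n. E n)"
    have incr: "\<bar>F z - F y\<bar> \<le> measure \<tau> {min y z..max y z}" for z
    proof -
      have *: "F b - F a \<le> measure \<tau> {a..b} \<and> F a \<le> F b" if "a \<le> b" for a b
      proof -
        have "F b \<le> measure \<tau> ({..a} \<union> {a..b})"
          unfolding F_def by (intro finite_measure_mono) (auto simp: \<tau>)
        also have "\<dots> \<le> F a + measure \<tau> {a..b}"
          unfolding F_def by (intro measure_subadditive) (auto simp: \<tau>)
        finally show ?thesis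
          using that unfolding F_def by (auto intro!: finite_measure_mono simp: \<tau>)
      qed
      show ?thesis using *[of y z] *[of z y] by (cases "y \<le> z") (auto simp: min_def max_def)
    qed
    have "((\<lambda>z. (F z - F y) / (z - y)) \<longlongrightarrow> 0) (at y)"
    proof (rule tendstoI)
      fix \<epsilon> :: real assume "0 < \<epsilon>"
      then obtain k where k: "inverse (real (Suc k)) < \<epsilon>" using reals_Archimedean by blast
      have "y \<notin> E k" "y \<notin> N" using n by auto
      then obtain \<delta> where \<delta>: "\<delta> > 0" "\<And>z. 0 < \<bar>z - y\<bar> \<Longrightarrow> \<bar>z - y\<bar> < \<delta> \<Longrightarrow>
          measure \<tau> {min y z..max y z} < inverse (real (Suc k)) * \<bar>z - y\<bar>"
        unfolding E_def by (auto simp: not_le)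
      show "\<forall>\<^sub>F z in at y. dist ((F z - F y) / (z - y)) 0 < \<epsilon>"
        unfolding eventually_at
      proof (intro exI[of _ \<delta>] conjI ballI impI \<delta>)
        fix z assume z: "z \<noteq> y \<and> dist z y < \<delta>"
        have "\<bar>F z - F y\<bar> < inverse (real (Suc k)) * \<bar>z - y\<bar>"
          using incr[of z] \<delta>(2)[of z] z by (auto simp: dist_real_def)
        also have "\<dots> \<le> \<epsilon> * \<bar>z - y\<bar>" using k by (intro mult_right_mono) auto
        finally show "dist ((F z - F y) / (z - y)) 0 < \<epsilon>"
          using z by (simp add: abs_divide field_simps)
      qed
    qed
    then show False using y by (simp add: has_field_derivative_iff)
  qed
  then have "negligible {y. \<not> (F has_real_derivative 0) (at y)}"
    using neg negligible_subset by blast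
  then have "{y. \<not> (F has_real_derivative 0) (at y)} \<in> null_sets lebesgue"
    by (simp add: negligible_iff_null_sets)
  then have "AE y in lebesgue. (F has_real_derivative 0) (at y)"
    by (rule AE_I') auto
  then show ?thesis
    by (simp add: AE_completion_iff F_def)
qed

text \<open>No atoms give continuity, charged intervals give strict growth, a null carrier gives
  derivative 0. The absence of mass below 0 turns \<open>{0..y}\<close> into the half-line of
  \<open>cdf\<close>.\<close>

lemma cont_strict_singular_measure:
  fixes \<tau> :: "real measure"
  assumes \<tau>: "sets \<tau> = sets borel" and fin: "finite_measure \<tau>"
    and N: "N \<in> sets borel" "emeasure lborel N = 0" "emeasure \<tau> (- N) = 0"
    and atom: "\<And>y. emeasure \<tau> {y} = 0"
    and neg: "emeasure \<tau> {..<0} = 0"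
    and pos: "\<And>a b. 0 \<le> a \<Longrightarrow> a < b \<Longrightarrow> b \<le> 1 \<Longrightarrow> 0 < emeasure \<tau> {a<..<b}"
  shows "cont_strict_singular (\<lambda>y. measure \<tau> {0..y})"
proof -
  interpret finite_measure \<tau> by (rule fin)
  interpret finite_borel_measure \<tau> using \<tau> by unfold_locales auto
  have eq: "measure \<tau> {0..y} = cdf \<tau> y" for y
  proof -
    have "cdf \<tau> y = measure \<tau> ({..y} - {..<0})"
      unfolding cdf_def using neg by (intro measure_Diff_null_set[symmetric]) (auto simp: null_sets_def \<tau>)
    also have "{..y} - {..<0} = {0..y}" by auto
    finally show ?thesis by simp
  qed
  have "isCont (cdf \<tau>) y" for y
    using atom[of y] by (simp add: isCont_cdf measure_def)
  moreover have "strict_mono_on {0..1} (cdf \<tau>)"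
  proof (rule strict_mono_onI)
    fix a b :: real assume ab: "a \<in> {0..1}" "b \<in> {0..1}" "a < b"
    have "0 < measure \<tau> {a<..<b}" using pos[of a b] ab by (simp add: emeasure_eq_measure)
    also have "\<dots> \<le> measure \<tau> {a<..b}" by (intro finite_measure_mono) (auto simp: \<tau>)
    also have "\<dots> = cdf \<tau> b - cdf \<tau> a" using ab by (simp add: cdf_diff_eq)
    finally show "cdf \<tau> a < cdf \<tau> b" by simp
  qed
  moreover have "AE y in lborel. (cdf \<tau> has_real_derivative 0) (at y)"
    using singular_cdf_has_derivative_zero[OF \<tau> fin N] by (simp add: cdf_def[abs_def])
  ultimately show ?thesis unfolding cont_strict_singular_def eq by simp
qed

section \<open>The generator of a radial measure\<close>

text \<open>The truncated power x_+^j / j!. The factorial makes differentiation lower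
  \<open>j\<close> by one; keeping the value at 0 makes the case j = 0 the indicator of the closed
  half-line.\<close>

definition tpow :: "nat \<Rightarrow> real \<Rightarrow> real" where
  "tpow j x = (if 0 \<le> x then x ^ j / fact j else 0)"

lemma tpow_nonneg [simp]: "0 \<le> tpow j x"
  by (simp add: tpow_def)

lemma tpow_pos: "0 < x \<Longrightarrow> 0 < tpow j x"
  by (simp add: tpow_def)

lemma tpow_measurable [measurable]: "tpow j \<in> borel_measurable borel"
  unfolding tpow_def[abs_def] by measurable

text \<open>Convexity of powers by induction: the slack for n + 1 is b times the slack for n plus a
  nonnegative multiple of (b - a)^2.\<close>

lemma power_tangent_le:
  fixes a b :: real
  assumes "0 \<le> a" "0 \<le> b"
  shows "real (Suc n) * a ^ n * (b - a) \<le> b ^ Suc n - a ^ Suc n"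
proof (induction n)
  case (Suc n)
  have "b ^ Suc (Suc n) - a ^ Suc (Suc n) - real (Suc (Suc n)) * a ^ Suc n * (b - a)
      = b * (b ^ Suc n - a ^ Suc n - real (Suc n) * a ^ n * (b - a)) + real (Suc n) * a ^ n * (b - a)\<^sup>2"
    by (simp add: algebra_simps power2_eq_square)
  also have "\<dots> \<ge> 0"
    using Suc assms by (intro add_nonneg_nonneg mult_nonneg_nonneg) auto
  finally show ?case by simp
qed simp

text \<open>Thus \<open>tpow j\<close> is a subgradient of the convex function
  \<open>tpow (Suc j)\<close> on the whole line, also at the kink at 0 for j = 0.\<close>

lemma tpow_tangent_le: "tpow j a * (b - a) \<le> tpow (Suc j) b - tpow (Suc j) a"
proof -
  consider "0 \<le> a" "0 \<le> b" | "0 \<le> a" "b < 0" | "a < 0" by linarith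
  then show ?thesis
  proof cases
    case 1
    have "a ^ j / fact j * (b - a) = real (Suc j) * a ^ j * (b - a) / fact (Suc j)"
      unfolding fact_Suc[of j, where 'a = real] by (simp del: of_nat_Suc)
    also have "\<dots> \<le> (b ^ Suc j - a ^ Suc j) / fact (Suc j)"
      by (intro divide_right_mono power_tangent_le 1) simp
    finally show ?thesis using 1 by (simp add: tpow_def diff_divide_distrib)
  next
    case 2
    have "a ^ j / fact j * (b - a) \<le> a ^ j / fact j * (- a)"
      using 2 by (intro mult_left_mono) auto
    also have "\<dots> = - (a ^ Suc j / fact j)" by simp
    also have "\<dots> \<le> - (a ^ Suc j / fact (Suc j))"
      using 2 by (simp del: power_Suc fact_Suc) (intro divide_left_mono fact_mono, auto)
    finally show ?thesis using 2 by (simp add: tpow_def)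
  next
    case 3
    then show ?thesis by (simp add: tpow_def)
  qed
qed

text \<open>The subgradient inequality used in both directions traps the difference quotient between
  f'(z) and f'(w). Subgradient inequalities survive integration, so derivatives are obtained without
  differentiating under the integral.\<close>

lemma has_derivative_if_subgradient:
  fixes f f' :: "real \<Rightarrow> real"
  assumes sub: "\<And>z w. f' z * (w - z) \<le> f w - f z" and cont: "isCont f' z"
  shows "(f has_real_derivative f' z) (at z)"
proof -
  have bound: "\<bar>(f w - f z) / (w - z) - f' z\<bar> \<le> \<bar>f' w - f' z\<bar>" if "w \<noteq> z" for w
  proof (cases "z < w")
    case True
    then have "f' z \<le> (f w - f z) / (w - z)" "(f w - f z) / (w - z) \<le> f' w"
      using sub[of z w] sub[of w z] by (auto simp: field_simps)
    then show ?thesis by linarith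
  next
    case False
    with that have "w < z" by simp
    then have "(f w - f z) / (w - z) \<le> f' z" "f' w \<le> (f w - f z) / (w - z)"
      using sub[of z w] sub[of w z] by (auto simp: field_simps)
    then show ?thesis by linarith
  qed
  have "((\<lambda>w. \<bar>f' w - f' z\<bar>) \<longlongrightarrow> 0) (at z)"
    using cont unfolding isCont_def by (simp add: LIM_zero tendsto_rabs_zero)
  then have "((\<lambda>w. (f w - f z) / (w - z) - f' z) \<longlongrightarrow> 0) (at z)"
    by (rule Lim_null_comparison[rotated]) (auto simp: eventually_at_filter bound)
  then show ?thesis
    unfolding has_field_derivative_iff by (rule LIM_zero_cancel)
qed

section \<open>Radial measures and their integrated truncated powers\<close>

locale radial_measure = finite_measure \<nu> for \<nu> :: "real measure" +
  fixes m :: nat and N :: "real set"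
  assumes sets_nu [measurable_cong, simp]: "sets \<nu> = sets borel"
    and nonpos: "emeasure \<nu> {..0} = 0"
    and atomless: "emeasure \<nu> {x} = 0"
    and N_borel [measurable]: "N \<in> sets borel"
    and N_null: "emeasure lborel N = 0"
    and N_conc: "emeasure \<nu> (- N) = 0"
    and full: "0 \<le> a \<Longrightarrow> a < b \<Longrightarrow> 0 < emeasure \<nu> {a<..<b}"
    and moment: "integrable \<nu> (\<lambda>r. \<bar>r\<bar> ^ m)"
    and m: "2 \<le> m"
begin

lemma space_nu [simp]: "space \<nu> = UNIV"
  using sets_eq_imp_space_eq[OF sets_nu] by simp

text \<open>Up to sign these are the derivatives of the later generator: \<open>g m\<close> becomes
  \<psi>, its k-th derivative is (-1)^k times \<open>g (m - k)\<close> for k \<le> m, and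
  \<open>g 0\<close> is the tail of \<nu>.\<close>

definition g :: "nat \<Rightarrow> real \<Rightarrow> real" where
  "g j z = (\<integral>r. tpow j (r - z) \<partial>\<nu>)"

text \<open>The moment of order m suffices for all lower orders: |r|^j is at most 1 + |r|^m, and
  constants are integrable because \<nu> is finite.\<close>

lemma integrable_tpow: "j \<le> m \<Longrightarrow> integrable \<nu> (\<lambda>r. tpow j (r - z))"
proof (rule Bochner_Integration.integrable_bound)
  show "integrable \<nu> (\<lambda>r. 2 ^ j * (1 + \<bar>r\<bar> ^ m + \<bar>z\<bar> ^ j))"
    using moment by simp
  assume j: "j \<le> m"
  have "tpow j (r - z) \<le> 2 ^ j * (1 + \<bar>r\<bar> ^ m + \<bar>z\<bar> ^ j)" for r
  proof -
    have "tpow j (r - z) \<le> \<bar>r - z\<bar> ^ j / fact j"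
      by (simp add: tpow_def)
    also have "\<dots> \<le> \<bar>r - z\<bar> ^ j"
      by (simp add: divide_le_eq mult_le_cancel_left1 fact_ge_1)
    also have "\<dots> \<le> (2 * max \<bar>r\<bar> \<bar>z\<bar>) ^ j"
      by (intro power_mono) auto
    also have "\<dots> = 2 ^ j * max \<bar>r\<bar> \<bar>z\<bar> ^ j" by (simp add: power_mult_distrib)
    also have "\<dots> \<le> 2 ^ j * (1 + \<bar>r\<bar> ^ m + \<bar>z\<bar> ^ j)"
    proof (intro mult_left_mono)
      have "\<bar>r\<bar> ^ j \<le> 1 + \<bar>r\<bar> ^ m"
      proof (cases "\<bar>r\<bar> \<le> 1")
        case True
        then have "\<bar>r\<bar> ^ j \<le> 1" by (simp add: power_le_one)
        then show ?thesis by (simp add: add_increasing2)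
      next
        case False
        then have "\<bar>r\<bar> ^ j \<le> \<bar>r\<bar> ^ m" using j by (intro power_increasing) auto
        then show ?thesis by simp
      qed
      then show "max \<bar>r\<bar> \<bar>z\<bar> ^ j \<le> 1 + \<bar>r\<bar> ^ m + \<bar>z\<bar> ^ j"
        by (auto simp: max_def add_increasing add_increasing2)
    qed simp
    finally show ?thesis .
  qed
  then show "AE r in \<nu>. norm (tpow j (r - z)) \<le> norm (2 ^ j * (1 + \<bar>r\<bar> ^ m + \<bar>z\<bar> ^ j))"
    by (intro AE_I2) (auto simp: abs_of_nonneg intro: order_trans)
qed simp

text \<open>The tangent inequality of the truncated powers, integrated over \<nu>; the sign is
  reversed because z enters as r - z. Convexity, differentiability and strict decrease are all read
  off from it.\<close>

lemma g_tangent_le: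
  assumes "Suc j \<le> m"
  shows "- g j z * (w - z) \<le> g (Suc j) w - g (Suc j) z"
proof -
  have "- g j z * (w - z) = (\<integral>r. tpow j (r - z) * (z - w) \<partial>\<nu>)"
    unfolding g_def by (subst integral_mult_left_zero) (simp add: algebra_simps)
  also have "\<dots> \<le> (\<integral>r. tpow (Suc j) (r - w) - tpow (Suc j) (r - z) \<partial>\<nu>)"
    using assms tpow_tangent_le[of j "r - z" "r - w" for r]
    by (intro Bochner_Integration.integral_mono) (auto simp: integrable_tpow)
  also have "\<dots> = g (Suc j) w - g (Suc j) z"
    unfolding g_def using assms by (intro Bochner_Integration.integral_diff integrable_tpow) auto
  finally show ?thesis .
qed

lemma g_0: "g 0 z = measure \<nu> {z..}"
proof -
  have "g 0 z = (\<integral>r. indicator {z..} r \<partial>\<nu>)"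
    unfolding g_def by (intro Bochner_Integration.integral_cong) (auto simp: tpow_def)
  then show ?thesis by simp
qed

text \<open>The tail of an atomless measure has no jumps. All smoothness of the generator starts
  from here.\<close>

lemma isCont_g_0: "isCont (g 0) z"
proof -
  interpret finite_borel_measure \<nu> by unfold_locales simp
  have "g 0 = (\<lambda>z. measure \<nu> UNIV - cdf \<nu> z)"
  proof
    fix z
    have "cdf \<nu> z = measure \<nu> ({..z} - {z})"
      unfolding cdf_def using atomless by (intro measure_Diff_null_set[symmetric]) (auto simp: null_sets_def)
    moreover have "measure \<nu> UNIV = measure \<nu> ({z..} \<union> ({..z} - {z}))"
      by (rule arg_cong[where f = "measure \<nu>"]) auto
    moreover have "\<dots> = measure \<nu> {z..} + measure \<nu> ({..z} - {z})"
      by (intro finite_measure_Union) auto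
    ultimately show "g 0 z = measure \<nu> UNIV - cdf \<nu> z" by (simp add: g_0)
  qed
  moreover have "isCont (cdf \<nu>) z"
    using atomless[of z] by (simp add: isCont_cdf measure_def)
  ultimately show ?thesis by (simp add: continuous_diff)
qed

text \<open>A bootstrap: continuity of \<open>g j\<close> turns the subgradient of
  \<open>g (Suc j)\<close> into a derivative, which makes \<open>g (Suc j)\<close> continuous in
  turn.\<close>

lemma g_continuous_and_derivative:
  "(j \<le> m \<longrightarrow> isCont (g j) z) \<and> (Suc j \<le> m \<longrightarrow> (g (Suc j) has_real_derivative - g j z) (at z))"
proof (induction j arbitrary: z)
  case 0
  show ?case
    using isCont_g_0 g_tangent_le[of 0] has_derivative_if_subgradient[of "\<lambda>z. - g 0 z" "g (Suc 0)" z]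
      continuous_minus[of "at z" "g 0"]
    by blast
next
  case (Suc j)
  have c: "Suc j \<le> m \<longrightarrow> isCont (g (Suc j)) z" for z
    using Suc DERIV_isCont by blast
  then show ?case
    using g_tangent_le[of "Suc j"] has_derivative_if_subgradient[of "\<lambda>z. - g (Suc j) z" "g (Suc (Suc j))" z]
      continuous_minus[of "at z" "g (Suc j)"] Suc_leD
    by blast
qed

lemma isCont_g: "j \<le> m \<Longrightarrow> isCont (g j) z"
  and g_deriv: "Suc j \<le> m \<Longrightarrow> (g (Suc j) has_real_derivative - g j z) (at z)"
  by (simp_all add: g_continuous_and_derivative)

lemma g_nonneg: "0 \<le> g j z"
  unfolding g_def by (intro Bochner_Integration.integral_nonneg) simp

text \<open>A zero integral would force \<nu> to miss the interval (z, z+1), where the integrand is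
  positive. For j = m this says that the generator never reaches 0.\<close>

lemma g_pos:
  assumes "j \<le> m" "0 \<le> z"
  shows "0 < g j z"
proof -
  have "g j z \<noteq> 0"
  proof
    assume "g j z = 0"
    then have "AE r in \<nu>. tpow j (r - z) = 0"
      unfolding g_def using assms by (subst (asm) integral_nonneg_eq_0_iff_AE) (auto simp: integrable_tpow)
    then have "AE r in \<nu>. r \<notin> {z<..<z+1}"
      by eventually_elim (metis diff_gt_0_iff_gt greaterThanLessThan_iff less_irrefl tpow_pos)
    then have "emeasure \<nu> {z<..<z+1} = 0"
      by (subst (asm) AE_iff_measurable[of "{z<..<z+1}"]) auto
    then show False using full[of z "z+1"] assms by simp
  qed
  then show ?thesis using g_nonneg[of j z] by simp
qed

lemma g_strict_anti:
  assumes "Suc j \<le> m" "0 \<le> z" "z < w"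
  shows "g (Suc j) w < g (Suc j) z"
proof -
  have "0 < g j w * (w - z)" using assms g_pos[of j w] by simp
  then show ?thesis using g_tangent_le[of j w z] assms by (simp add: algebra_simps)
qed

lemma g_antimono: "j \<le> m \<Longrightarrow> z \<le> w \<Longrightarrow> g j w \<le> g j z"
  unfolding g_def
  by (intro integral_mono integrable_tpow) (auto simp: tpow_def intro!: divide_right_mono power_mono)

text \<open>With d = m + 1 this is the convexity required at order d - 2 = m - 1. It is the weighted
  sum of the two tangent inequalities at the intermediate point.\<close>

lemma convex_g_1: "convex_on {0<..} (g 1)"
proof (rule convex_onI)
  fix t x y :: real assume t: "0 < t" "t < 1"
  let ?w = "(1 - t) * x + t * y"
  have 1: "- g 0 ?w * (x - ?w) \<le> g 1 x - g 1 ?w" and 2: "- g 0 ?w * (y - ?w) \<le> g 1 y - g 1 ?w"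
    using g_tangent_le[of 0] m by auto
  have "(1 - t) * (- g 0 ?w * (x - ?w)) + t * (- g 0 ?w * (y - ?w))
      \<le> (1 - t) * (g 1 x - g 1 ?w) + t * (g 1 y - g 1 ?w)"
    using 1 2 t by (intro add_mono mult_left_mono) auto
  moreover have "(1 - t) * (- g 0 ?w * (x - ?w)) + t * (- g 0 ?w * (y - ?w)) = 0"
    by (simp add: algebra_simps)
  ultimately show "g 1 ((1 - t) *\<^sub>R x + t *\<^sub>R y) \<le> (1 - t) * g 1 x + t * g 1 y"
    by (simp add: algebra_simps)
qed simp

lemma g_tendsto_0: "(g m \<longlongrightarrow> 0) at_top"
proof -
  have "((\<lambda>z. \<integral>r. tpow m (r - z) \<partial>\<nu>) \<longlongrightarrow> (\<integral>r. 0 \<partial>\<nu>)) at_top"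
  proof (rule integral_dominated_convergence_at_top)
    show "integrable \<nu> (\<lambda>r. tpow m (r - 0))" by (rule integrable_tpow) simp
    show "\<forall>\<^sub>F z in at_top. AE r in \<nu>. norm (tpow m (r - z)) \<le> tpow m (r - 0)"
      using eventually_ge_at_top[of 0]
      by eventually_elim (auto simp: tpow_def intro!: AE_I2 divide_right_mono power_mono)
    have "((\<lambda>z. tpow m (r - z)) \<longlongrightarrow> 0) at_top" for r
      by (rule tendsto_eventually) (use eventually_gt_at_top[of r] in eventually_elim, simp add: tpow_def)
    then show "AE r in \<nu>. ((\<lambda>z. tpow m (r - z)) \<longlongrightarrow> 0) at_top" by simp
  qed auto
  then show ?thesis by (simp add: g_def[abs_def])
qed

end

section \<open>The generator, its inverse and images of null sets\<close>

locale normalized_radial_measure = radial_measure +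
  assumes norm_0: "g m 0 = 1" and norm_1: "g m 1 = 1 / 2"
begin

definition \<psi> :: "real \<Rightarrow> real" where "\<psi> = g m"

lemma psi_0 [simp]: "\<psi> 0 = 1" and psi_1: "\<psi> 1 = 1 / 2"
  using norm_0 norm_1 by (auto simp: \<psi>_def)

lemma psi_anti: "z \<le> w \<Longrightarrow> \<psi> w \<le> \<psi> z"
  unfolding \<psi>_def by (rule g_antimono) auto

lemma psi_strict_anti: "0 \<le> z \<Longrightarrow> z < w \<Longrightarrow> \<psi> w < \<psi> z"
  unfolding \<psi>_def using g_strict_anti[of "m - 1"] m by simp

lemma psi_le_iff: "0 \<le> z \<Longrightarrow> 0 \<le> w \<Longrightarrow> \<psi> w \<le> \<psi> z \<longleftrightarrow> z \<le> w"
  using psi_anti psi_strict_anti by (meson linorder_not_le)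

lemma psi_pos: "0 \<le> z \<Longrightarrow> 0 < \<psi> z"
  unfolding \<psi>_def by (rule g_pos) auto

lemma psi_nonneg: "0 \<le> \<psi> z"
  unfolding \<psi>_def by (rule g_nonneg)

lemma psi_le_1: "0 \<le> z \<Longrightarrow> \<psi> z \<le> 1"
  using psi_anti[of 0 z] by simp

lemma isCont_psi: "isCont \<psi> z"
  unfolding \<psi>_def by (rule isCont_g) simp

lemma psi_differentiable_on: "\<psi> differentiable_on S"
proof -
  have "(\<psi> has_real_derivative - g (m - 1) x) (at x)" for x
    using g_deriv[of "m - 1" x] m by (simp add: \<psi>_def)
  then show ?thesis
    by (meson differentiable_at_imp_differentiable_on real_differentiable_def)
qed

lemma psi_tendsto_0: "(\<psi> \<longlongrightarrow> 0) at_top"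
  unfolding \<psi>_def by (rule g_tendsto_0)

lemma psi_measurable [measurable]: "\<psi> \<in> borel_measurable borel"
  by (intro borel_measurable_continuous_onI) (simp add: continuous_on_eq_continuous_at isCont_psi)

lemma arch_generator_psi: "arch_generator (Suc m) \<psi>"
  unfolding arch_generator_def
proof (intro conjI)
  show "continuous_on {0..} \<psi>"
    by (simp add: continuous_on_eq_continuous_at isCont_psi continuous_at_imp_continuous_on)
  show "\<psi> ` {0..} \<subseteq> {0..1}" using psi_nonneg psi_le_1 by auto
  show "\<forall>x y. 0 \<le> x \<and> x \<le> y \<longrightarrow> \<psi> y \<le> \<psi> x" using psi_anti by auto
  show "(\<psi> \<longlongrightarrow> 0) at_top" by (rule psi_tendsto_0)
  show "strict_antimono_on {z. 0 \<le> z \<and> (\<forall>w. 0 \<le> w \<and> \<psi> w = 0 \<longrightarrow> z \<le> w)} \<psi>"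
    by (auto simp: monotone_on_def intro: psi_strict_anti)
  \<comment> \<open>Each derivative lowers the index and flips the sign; at order
    \<open>Suc m - 2\<close>, that is m - 1, the two signs cancel and \<open>g 1\<close> is
    left.\<close>
  define f where "f k x = (-1) ^ k * g (m - k) x" for k x
  have last: "(-1) ^ (Suc m - 2) * f (Suc m - 2) x = g 1 x" for x
    using m by (simp add: f_def power_mult_distrib[symmetric] mult.assoc[symmetric] Suc_diff_Suc)
  show "\<exists>f. (\<forall>x>0. f 0 x = \<psi> x) \<and>
        (\<forall>k<Suc m - 2. \<forall>x>0. (f k has_real_derivative f (Suc k) x) (at x)) \<and>
        (\<forall>x>0. 0 \<le> (-1) ^ (Suc m - 2) * f (Suc m - 2) x) \<and>
        (\<forall>x y. 0 < x \<and> x \<le> y \<longrightarrow> (-1) ^ (Suc m - 2) * f (Suc m - 2) y \<le> (-1) ^ (Suc m - 2) * f (Suc m - 2) x) \<and>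
        convex_on {0<..} (\<lambda>x. (-1) ^ (Suc m - 2) * f (Suc m - 2) x)"
    unfolding One_nat_def[symmetric]
  proof (intro exI[of _ f] conjI allI impI)
    show "f 0 x = \<psi> x" for x by (simp add: f_def \<psi>_def)
    show "(f k has_real_derivative f (Suc k) x) (at x)" if "k < Suc m - 2" for k x
    proof -
      have "(g (Suc (m - Suc k)) has_real_derivative - g (m - Suc k) x) (at x)"
        by (rule g_deriv) (use that in auto)
      moreover have "Suc (m - Suc k) = m - k" using that by auto
      ultimately show ?thesis
        unfolding f_def using DERIV_cmult[of "g (m - k)" "- g (m - Suc k) x" x UNIV "(-1) ^ k"] by auto
    qed
    show "0 \<le> (-1) ^ (Suc m - 2) * f (Suc m - 2) x" for x
      unfolding last by (rule g_nonneg)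
    show "(-1) ^ (Suc m - 2) * f (Suc m - 2) y \<le> (-1) ^ (Suc m - 2) * f (Suc m - 2) x"
      if "0 < x \<and> x \<le> y" for x y
      unfolding last using that m by (intro g_antimono) auto
    show "convex_on {0<..} (\<lambda>x. (-1) ^ (Suc m - 2) * f (Suc m - 2) x)"
      unfolding last by (rule convex_g_1)
  qed
qed (auto simp: psi_1)

abbreviation "\<phi> \<equiv> pseudo_inv \<psi>"

lemma phi_psi [simp]:
  assumes "0 \<le> z" shows "\<phi> (\<psi> z) = z"
proof -
  have "{w. 0 \<le> w \<and> \<psi> w \<le> \<psi> z} = {z..}"
    using assms psi_le_iff[of z] by auto
  then show ?thesis by (simp add: pseudo_inv_def)
qed

lemma psi_surj:
  assumes "0 < t" "t \<le> 1"
  obtains z where "0 \<le> z" "t = \<psi> z"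
proof -
  have "\<forall>\<^sub>F z in at_top. \<psi> z < t" by (rule order_tendstoD(2)[OF psi_tendsto_0 assms(1)])
  then obtain b where b: "\<psi> b < t" "0 \<le> b"
    using eventually_happens'[OF _ eventually_conj[OF _ eventually_ge_at_top[of 0]]] by force
  have "\<exists>z. 0 \<le> z \<and> z \<le> b \<and> \<psi> z = t"
    using b assms by (intro IVT2) (auto simp: isCont_psi)
  then show ?thesis using that by blast
qed

lemma phi_nonneg: "0 < t \<Longrightarrow> t \<le> 1 \<Longrightarrow> 0 \<le> \<phi> t"
  and psi_phi: "0 < t \<Longrightarrow> t \<le> 1 \<Longrightarrow> \<psi> (\<phi> t) = t"
  by (metis phi_psi psi_surj)+

lemma psi_le_iff_phi: "0 < t \<Longrightarrow> t \<le> 1 \<Longrightarrow> 0 \<le> a \<Longrightarrow> \<psi> a \<le> t \<longleftrightarrow> \<phi> t \<le> a"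
  using psi_le_iff[of "\<phi> t" a] phi_nonneg[of t] psi_phi[of t] by simp

text \<open>A total version of the inverse. At t \<le> 0 the pseudo-inverse is the infimum of the
  empty set, since \<psi> has no zero; the default 0 makes the function nonnegative and measurable
  on the whole line.\<close>

definition \<Phi> :: "real \<Rightarrow> real" where
  "\<Phi> t = (if 0 < t \<and> t \<le> 1 then \<phi> t else 0)"

lemma Phi_nonneg: "0 \<le> \<Phi> t"
  by (simp add: \<Phi>_def phi_nonneg)

lemma Phi_psi [simp]: "0 \<le> z \<Longrightarrow> \<Phi> (\<psi> z) = z"
  by (simp add: \<Phi>_def psi_pos psi_le_1)

lemma Phi_measurable [measurable]: "\<Phi> \<in> borel_measurable borel"
  unfolding borel_measurable_iff_le
proof
  fix a :: real
  have "{t. \<Phi> t \<le> a} = (if a < 0 then {} else {t. 0 < t \<and> t \<le> 1 \<longrightarrow> \<psi> a \<le> t})"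
  proof (cases "a < 0")
    case True
    then have "\<not> \<Phi> t \<le> a" for t using Phi_nonneg[of t] by simp
    then show ?thesis using True by simp
  next
    case False
    then have "\<Phi> t \<le> a \<longleftrightarrow> (0 < t \<and> t \<le> 1 \<longrightarrow> \<psi> a \<le> t)" for t
      by (auto simp: \<Phi>_def psi_le_iff_phi)
    then show ?thesis using False by simp
  qed
  then show "{t \<in> space borel. \<Phi> t \<le> a} \<in> sets borel"
    by simp
qed

text \<open>The set lies in the image under \<psi> of a translate of \<open>N\<close>, and a
  differentiable image of a negligible set is negligible. With a general s this serves the
  conditional laws and the fibres of the copula law, with s = 0 the Kendall law.\<close>

lemma psi_image_null:
  shows "{y. 0 < y \<and> y \<le> 1 \<and> s + \<Phi> y \<in> N} \<in> sets borel" (is "?A \<in> _")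
    and "emeasure lborel {y. 0 < y \<and> y \<le> 1 \<and> s + \<Phi> y \<in> N} = 0"
proof -
  show meas: "?A \<in> sets borel" by measurable
  have "negligible N" using N_null by (simp add: negligible_iff_null_sets null_sets_def)
  then have "negligible ((+) (- s) ` N)" by (rule negligible_translation)
  then have "negligible (\<psi> ` ((+) (- s) ` N))"
    by (rule negligible_differentiable_image_negligible[OF order_refl _ psi_differentiable_on])
  moreover have "?A \<subseteq> \<psi> ` ((+) (- s) ` N)"
  proof
    fix y assume "y \<in> ?A"
    then have "y = \<psi> (\<Phi> y)" "\<Phi> y = - s + (s + \<Phi> y)" "s + \<Phi> y \<in> N"
      by (auto simp: \<Phi>_def psi_phi)
    then show "y \<in> \<psi> ` ((+) (- s) ` N)" by blast
  qed
  ultimately have "negligible ?A" by (rule negligible_subset)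
  then show "emeasure lborel ?A = 0"
    using meas by (auto simp: negligible_iff_null_sets null_sets_def)
qed

end

section \<open>Existence of a singular radial measure\<close>

definition rational_seq :: "nat \<Rightarrow> real" where
  "rational_seq = from_nat_into \<rat>"

lemma rational_seq_bij: "bij_betw rational_seq UNIV \<rat>"
  unfolding rational_seq_def by (rule bij_betw_from_nat_into) (auto simp: countable_rat Rats_infinite)

lemma rational_seq_between:
  assumes "a < b"
  obtains n where "a < rational_seq n" "rational_seq n < b"
proof -
  obtain q where "q \<in> \<rat>" "a < q" "q < b" using Rats_dense_in_real[OF assms] by blast
  moreover have "\<rat> = range rational_seq" using rational_seq_bij by (simp add: bij_betw_def)
  ultimately show ?thesis using that by (metis imageE)
qed

text \<open>The left-continuous pure-jump function with a jump of size 2^-(n+1) at the n-th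
  rational. It is injective because the rationals are dense, and its total increase is used up by
  jumps.\<close>

definition jump :: "real \<Rightarrow> real" where
  "jump x = (\<Sum>n. if rational_seq n < x then (1 / 2) ^ Suc n else 0)"

lemma summable_jump: "summable (\<lambda>n. if P n then (1 / 2 :: real) ^ Suc n else 0)"
  by (rule summable_comparison_test'[OF sums_summable[OF power_half_series], of 0]) auto

lemma jump_mono_terms:
  assumes "\<And>n. P n \<Longrightarrow> P' n"
  shows "(\<Sum>n. if P n then (1 / 2 :: real) ^ Suc n else 0) \<le> (\<Sum>n. if P' n then (1 / 2) ^ Suc n else 0)"
  using assms by (intro suminf_le summable_jump) auto

lemma jump_mono: "x \<le> y \<Longrightarrow> jump x \<le> jump y"
  unfolding jump_def by (intro jump_mono_terms) auto

lemma jump_ge_0: "0 \<le> jump x"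
  unfolding jump_def by (intro suminf_nonneg summable_jump) auto

lemma jump_le_1: "jump x \<le> 1"
proof -
  have "jump x \<le> (\<Sum>n. if True then (1 / 2 :: real) ^ Suc n else 0)"
    unfolding jump_def by (rule jump_mono_terms) simp
  then show ?thesis using sums_unique[OF power_half_series] by simp
qed

text \<open>Termwise comparison of series: the summand of index n is absent from
  \<open>jump (rational_seq n)\<close>, the defining inequality being strict, but present in
  \<open>jump x\<close>, so it may be added without being counted twice.\<close>

lemma jump_gap:
  assumes "rational_seq n < x"
  shows "jump (rational_seq n) + (1 / 2) ^ Suc n \<le> jump x"
proof -
  let ?q = "rational_seq"
  have "(\<lambda>k. if k = n then (1 / 2 :: real) ^ Suc n else 0) sums ((1 / 2) ^ Suc n)"
    by (rule sums_single)
  moreover have "(\<lambda>k. if ?q k < ?q n then (1 / 2 :: real) ^ Suc k else 0) sums jump (?q n)"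
    unfolding jump_def by (rule summable_sums[OF summable_jump])
  ultimately have "(\<lambda>k. (if ?q k < ?q n then (1 / 2 :: real) ^ Suc k else 0) + (if k = n then (1 / 2) ^ Suc n else 0))
      sums (jump (?q n) + (1 / 2) ^ Suc n)"
    by (intro sums_add)
  moreover have "(\<lambda>k. if ?q k < x then (1 / 2 :: real) ^ Suc k else 0) sums jump x"
    unfolding jump_def by (rule summable_sums[OF summable_jump])
  ultimately show ?thesis
    using assms by (elim sums_le[rotated]) auto
qed

lemma jump_strict_mono: "x < y \<Longrightarrow> jump x < jump y"
proof -
  assume "x < y"
  then obtain n where n: "x < rational_seq n" "rational_seq n < y" by (rule rational_seq_between)
  have "jump x \<le> jump (rational_seq n)" using n by (intro jump_mono) simp
  also have "\<dots> < jump (rational_seq n) + (1 / 2) ^ Suc n" by simp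
  also have "\<dots> \<le> jump y" using n by (intro jump_gap) simp
  finally show ?thesis .
qed

definition jump_gap_set :: "nat \<Rightarrow> real set" where
  "jump_gap_set n = {jump (rational_seq n) <..< jump (rational_seq n) + (1 / 2) ^ Suc n}"

text \<open>The gaps at the jumps are disjoint intervals in the unit interval whose lengths add up to 1,
  so the range of the jump function is a null set.\<close>

definition jump_range :: "real set" where
  "jump_range = {0..1} - (\<Union>n. jump_gap_set n)"

lemma jump_range_borel [measurable]: "jump_range \<in> sets borel"
  unfolding jump_range_def jump_gap_set_def by measurable

lemma jump_in_range: "jump x \<in> jump_range"
proof -
  have "jump x \<notin> jump_gap_set n" for n
    using jump_gap[of n x] jump_mono[of x "rational_seq n"] by (cases "rational_seq n < x") (auto simp: jump_gap_set_def)
  then show ?thesis using jump_ge_0 jump_le_1 by (auto simp: jump_range_def)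
qed

lemma jump_range_null: "emeasure lborel jump_range = 0"
proof -
  have ord: "jump_gap_set k \<inter> jump_gap_set n = {}" if "rational_seq k < rational_seq n" for k n
    using jump_gap[OF that] by (auto simp: jump_gap_set_def)
  have "disjoint_family jump_gap_set"
    unfolding disjoint_family_on_def
  proof (intro ballI impI)
    fix k n :: nat assume "k \<noteq> n"
    then have "rational_seq k \<noteq> rational_seq n"
      using rational_seq_bij by (auto simp: bij_betw_def inj_on_def)
    then show "jump_gap_set k \<inter> jump_gap_set n = {}"
      using ord[of k n] ord[of n k] by (metis Int_commute linorder_neqE_linordered_idom)
  qed
  moreover have "range jump_gap_set \<subseteq> sets lborel" by (auto simp: jump_gap_set_def)
  ultimately have "emeasure lborel (\<Union>n. jump_gap_set n) = (\<Sum>n. emeasure lborel (jump_gap_set n))"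
    by (intro suminf_emeasure[symmetric])
  also have "\<dots> = (\<Sum>n. ennreal ((1 / 2) ^ Suc n))"
    by (simp add: jump_gap_set_def)
  also have "\<dots> = ennreal 1"
    using power_half_series by (intro suminf_ennreal_eq) auto
  finally have U: "emeasure lborel (\<Union>n. jump_gap_set n) = 1" by simp
  have sub: "(\<Union>n. jump_gap_set n) \<subseteq> {0..1}"
  proof (rule UN_least)
    fix n
    show "jump_gap_set n \<subseteq> {0..1}"
      using jump_gap[of n "rational_seq n + 1"] jump_ge_0[of "rational_seq n"] jump_le_1[of "rational_seq n + 1"]
      by (auto simp: jump_gap_set_def)
  qed
  have "emeasure lborel jump_range = emeasure lborel {0..1::real} - emeasure lborel (\<Union>n. jump_gap_set n)"
    unfolding jump_range_def using U sub by (intro emeasure_Diff) (auto simp: jump_gap_set_def)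
  then show ?thesis using U by simp
qed

lemma jump_measurable [measurable]: "jump \<in> borel_measurable borel"
  by (intro borel_measurable_mono monoI jump_mono)

text \<open>The image of the uniform distribution under an injection with null range is singular and
  atomless; an independent rational shift makes its support the whole line.\<close>

lemma exists_singular_atomless_full_support:
  obtains \<nu> :: "real measure" and N where "finite_measure \<nu>" "sets \<nu> = sets borel" "N \<in> sets borel"
    "emeasure lborel N = 0" "emeasure \<nu> (- N) = 0" "\<And>x. emeasure \<nu> {x} = 0"
    "\<And>a b. a < b \<Longrightarrow> 0 < emeasure \<nu> {a<..<b}"
proof -
  define U where "U = uniform_measure lborel {0<..<1::real}"
  \<comment> \<open>The geometric law is used only because it gives every shift positive
    weight.\<close>
  define Q where "Q = measure_pmf (geometric_pmf (1 / 2))"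
  interpret U: prob_space U unfolding U_def by (rule prob_space_uniform_measure) auto
  interpret Q: prob_space Q unfolding Q_def by (rule prob_space_measure_pmf)
  interpret P: pair_prob_space U Q ..
  have [measurable_cong]: "sets U = sets borel" "sets Q = sets (count_space UNIV)"
    by (simp_all add: U_def Q_def)
  have spQ: "space Q = UNIV" and spU: "space U = UNIV" by (simp_all add: Q_def U_def)
  let ?f = "\<lambda>(y, n). jump y + rational_seq n"
  have f [measurable]: "?f \<in> borel_measurable (U \<Otimes>\<^sub>M Q)" by measurable
  define \<nu> where "\<nu> = distr (U \<Otimes>\<^sub>M Q) borel ?f"
  \<comment> \<open>Countably many translates of a null set still form a null set, and every shifted
    value of \<open>jump\<close> falls into one of them.\<close>
  define N where "N = (\<Union>n. {x. x - rational_seq n \<in> jump_range})"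
  have em: "emeasure \<nu> B = (\<integral>\<^sup>+n. emeasure U {y. jump y + rational_seq n \<in> B} \<partial>Q)"
    if [measurable]: "B \<in> sets borel" for B
  proof -
    have "emeasure \<nu> B = emeasure (U \<Otimes>\<^sub>M Q) (?f -` B \<inter> space (U \<Otimes>\<^sub>M Q))"
      unfolding \<nu>_def by (rule emeasure_distr) measurable
    also have "\<dots> = (\<integral>\<^sup>+n. emeasure U ((\<lambda>y. (y, n)) -` (?f -` B \<inter> space (U \<Otimes>\<^sub>M Q))) \<partial>Q)"
      by (rule P.emeasure_pair_measure_alt2) measurable
    finally show ?thesis by (simp add: space_pair_measure spQ spU vimage_def)
  qed
  have U_point: "emeasure U {y. jump y + q = x} = 0" for q x
  proof -
    \<comment> \<open>By injectivity the fibre has at most one point, and the choice operator names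
      it; an empty fibre is covered as well.\<close>
    have "{y. jump y + q = x} \<subseteq> {SOME y. jump y + q = x}"
    proof
      fix y assume y: "y \<in> {y. jump y + q = x}"
      define z where "z = (SOME y. jump y + q = x)"
      have "jump z + q = x" unfolding z_def using y by (metis (mono_tags) mem_Collect_eq someI)
      then have "jump y = jump z" using y by simp
      then have "y = z" using jump_strict_mono[of y z] jump_strict_mono[of z y] by (cases y z rule: linorder_cases) auto
      then show "y \<in> {SOME y. jump y + q = x}" by (simp add: z_def)
    qed
    then have "emeasure U {y. jump y + q = x} \<le> emeasure U {SOME y. jump y + q = x}"
      by (intro emeasure_mono) (auto simp: U_def)
    also have "\<dots> \<le> 0"
      unfolding U_def by (subst emeasure_uniform_measure) (auto simp: Int_insert_right)
    finally show ?thesis by simp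
  qed
  show thesis
  proof (rule that[of \<nu> N])
    show "finite_measure \<nu>" unfolding \<nu>_def by (intro P.finite_measure_distr) measurable
    show "sets \<nu> = sets borel" by (simp add: \<nu>_def)
    show N: "N \<in> sets borel" unfolding N_def by measurable
    have neg: "negligible {x. x - rational_seq n \<in> jump_range}" for n
    proof -
      have "negligible jump_range" using jump_range_null by (simp add: negligible_iff_null_sets null_sets_def)
      then have "negligible ((+) (rational_seq n) ` jump_range)" by (rule negligible_translation)
      moreover have "{x. x - rational_seq n \<in> jump_range} = (+) (rational_seq n) ` jump_range"
        by (force simp: image_iff)
      ultimately show ?thesis by simp
    qed
    have "negligible N"
      unfolding N_def by (rule negligible_countable_Union) (auto simp: neg)
    then show "emeasure lborel N = 0"
      using N by (simp add: negligible_iff_null_sets null_sets_def)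
    have "jump y + rational_seq n \<in> N" for y n
      unfolding N_def using jump_in_range[of y] by (intro UN_I[of n]) auto
    then show "emeasure \<nu> (- N) = 0" using N by (subst em) auto
    show "emeasure \<nu> {x} = 0" for x by (subst em) (auto simp: U_point)
    fix a b :: real assume ab: "a < b"
    show "0 < emeasure \<nu> {a<..<b}"
    proof (rule ccontr)
      assume "\<not> 0 < emeasure \<nu> {a<..<b}"
      then have "(\<integral>\<^sup>+n. emeasure U {y. jump y + rational_seq n \<in> {a<..<b}} \<partial>Q) = 0"
        by (simp add: em)
      then have "AE n in Q. emeasure U {y. jump y + rational_seq n \<in> {a<..<b}} = 0"
        by (subst (asm) nn_integral_0_iff_AE) (auto simp: Q_def)
      then have "\<And>n. emeasure U {y. jump y + rational_seq n \<in> {a<..<b}} = 0"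
        unfolding Q_def by (simp add: AE_measure_pmf_iff set_pmf_geometric)
      moreover have "{y. jump y + rational_seq n \<in> {a<..<b}} \<in> sets U" for n
        by measurable
      ultimately have "emeasure U (\<Union>n. {y. jump y + rational_seq n \<in> {a<..<b}}) = 0"
        by (intro emeasure_UN_eq_0) auto
      \<comment> \<open>Some rational shift moves a given point into (a, b). If every shift
        contributed nothing, the whole line would be null for the uniform law.\<close>
      moreover have "(\<Union>n. {y. jump y + rational_seq n \<in> {a<..<b}}) = UNIV"
      proof (intro equalityI subsetI UNIV_I)
        fix y
        have "a - jump y < b - jump y" using ab by simp
        then obtain n where "a - jump y < rational_seq n" "rational_seq n < b - jump y"
          by (rule rational_seq_between)
        then show "y \<in> (\<Union>n. {y. jump y + rational_seq n \<in> {a<..<b}})"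
          by (intro UN_I[of n]) auto
      qed
      ultimately show False using U.emeasure_space_1 by (simp add: spU)
    qed
  qed
qed

text \<open>A bounded weight is applied that vanishes on the nonpositive axis, is positive beyond
  it, and decays so fast that its product with |r|^m is at most 1. A density creates no new mass on
  null sets, so the carrier and the absence of atoms persist; positivity of the weight keeps all
  intervals of the half-line charged.\<close>

lemma exists_radial_measure:
  assumes m: "2 \<le> m"
  obtains \<nu> N where "radial_measure \<nu> m N"
proof -
  obtain \<nu> :: "real measure" and N where fin: "finite_measure \<nu>" and sets [measurable_cong]: "sets \<nu> = sets borel"
    and N [measurable]: "N \<in> sets borel" and Nn: "emeasure lborel N = 0" "emeasure \<nu> (- N) = 0"
    and atom: "\<And>x. emeasure \<nu> {x} = 0" and full: "\<And>a b. a < b \<Longrightarrow> 0 < emeasure \<nu> {a<..<b}"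
    using exists_singular_atomless_full_support by blast
  interpret finite_measure \<nu> by (rule fin)
  define w where "w r = indicator {0<..} r / (1 + \<bar>r\<bar> ^ m)" for r :: real
  have [measurable]: "w \<in> borel_measurable borel" unfolding w_def by measurable
  have w: "0 \<le> w r" "w r \<le> 1" for r by (auto simp: w_def indicator_def divide_le_eq_1)
  have w_pos: "0 < w r" if "0 < r" for r
    using that by (simp add: w_def add_pos_nonneg)
  define \<kappa> where "\<kappa> = density \<nu> (\<lambda>r. ennreal (w r))"
  have em: "emeasure \<kappa> B = (\<integral>\<^sup>+r. ennreal (w r) * indicator B r \<partial>\<nu>)" if "B \<in> sets borel" for B
    unfolding \<kappa>_def using that by (intro emeasure_density) (auto simp: sets)
  have null: "emeasure \<kappa> B = 0" if "B \<in> sets borel" "emeasure \<nu> B = 0" for B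
  proof -
    have "emeasure \<kappa> B \<le> (\<integral>\<^sup>+r. indicator B r \<partial>\<nu>)"
      unfolding em[OF that(1)] using w(2) by (intro nn_integral_mono) (auto simp: indicator_def)
    then show ?thesis using that by (simp add: sets)
  qed
  show thesis
  proof (rule that, intro radial_measure.intro radial_measure_axioms.intro)
    show "finite_measure \<kappa>"
    proof
      have "emeasure \<kappa> UNIV = (\<integral>\<^sup>+r. ennreal (w r) \<partial>\<nu>)"
        by (subst em) auto
      also have "\<dots> \<le> (\<integral>\<^sup>+r. 1 \<partial>\<nu>)"
        using w(2) by (intro nn_integral_mono) simp
      also have "\<dots> < \<infinity>" by (simp add: less_top[symmetric])
      finally show "emeasure \<kappa> (space \<kappa>) \<noteq> \<infinity>"
        using sets_eq_imp_space_eq[OF sets] by (simp add: \<kappa>_def)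
    qed
    show "sets \<kappa> = sets borel" by (simp add: \<kappa>_def sets)
    show "emeasure \<kappa> {..0} = 0"
    proof (subst em)
      have "(\<lambda>r. ennreal (w r) * indicator {..0} r) = (\<lambda>_. 0)"
        by (auto simp: w_def indicator_def)
      then show "(\<integral>\<^sup>+r. ennreal (w r) * indicator {..0} r \<partial>\<nu>) = 0" by simp
    qed simp
    show "emeasure \<kappa> {x} = 0" for x by (rule null) (simp_all add: atom)
    show "emeasure \<kappa> (- N) = 0" by (rule null) (simp_all add: Nn)
    show "0 < emeasure \<kappa> {a<..<b}" if ab: "0 \<le> a" "a < b" for a b
    proof (rule ccontr)
      assume "\<not> 0 < emeasure \<kappa> {a<..<b}"
      then have "(\<integral>\<^sup>+r. ennreal (w r) * indicator {a<..<b} r \<partial>\<nu>) = 0" by (simp add: em)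
      then have "AE r in \<nu>. ennreal (w r) * indicator {a<..<b} r = 0"
        by (subst (asm) nn_integral_0_iff_AE) auto
      then have "AE r in \<nu>. r \<notin> {a<..<b}"
      proof eventually_elim
        case (elim r)
        then show ?case using w_pos[of r] ab by (auto simp: indicator_def split: if_splits)
      qed
      then have "emeasure \<nu> {a<..<b} = 0"
        using sets_eq_imp_space_eq[OF sets] by (subst (asm) AE_iff_measurable[of "{a<..<b}"]) (auto simp: sets)
      then show False using full[OF ab(2)] by simp
    qed
    have "integrable \<nu> (\<lambda>r. w r *\<^sub>R \<bar>r\<bar> ^ m)"
    proof (rule Bochner_Integration.integrable_bound[of _ "\<lambda>_. 1 :: real"])
      show "AE r in \<nu>. norm (w r *\<^sub>R \<bar>r\<bar> ^ m) \<le> norm (1 :: real)"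
        by (intro AE_I2) (auto simp: w_def indicator_def divide_le_eq_1 abs_mult add_pos_nonneg)
    qed auto
    then show "integrable \<kappa> (\<lambda>r. \<bar>r\<bar> ^ m)"
      unfolding \<kappa>_def using w by (subst integrable_density) auto
  qed (use N Nn m in auto)
qed

section \<open>Normalisation by dilation and scaling\<close>

context radial_measure
begin

text \<open>The class of radial measures is stable under r \<mapsto> r / z and under constant
  factors. The second claim shows the effect on the generator: two free parameters for the two
  values at 0 and 1.\<close>

lemma dilation:
  assumes z: "0 < z" and c: "0 < c"
  defines "\<kappa> \<equiv> density (distr \<nu> borel (\<lambda>r. r / z)) (\<lambda>_. ennreal c)"
  shows "radial_measure \<kappa> m {r. z * r \<in> N}"
    and "(\<integral>r. tpow m (r - y) \<partial>\<kappa>) = c / z ^ m * g m (z * y)"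
proof -
  have sets [simp, measurable_cong]: "sets \<kappa> = sets borel" by (simp add: \<kappa>_def)
  have em: "emeasure \<kappa> B = ennreal c * emeasure \<nu> {r. r / z \<in> B}" if "B \<in> sets borel" for B
    unfolding \<kappa>_def using that by (subst emeasure_density_const) (auto simp: emeasure_distr vimage_def)
  have tp: "tpow m (r / z - y) = tpow m (r - z * y) / z ^ m" for r
  proof -
    have "r / z - y = (r - z * y) / z" using z by (simp add: field_simps)
    then show ?thesis using z by (simp add: tpow_def power_divide zero_le_divide_iff)
  qed
  show "(\<integral>r. tpow m (r - y) \<partial>\<kappa>) = c / z ^ m * g m (z * y)"
    unfolding \<kappa>_def using c by (simp add: integral_density integral_distr tp g_def)
  show "radial_measure \<kappa> m {r. z * r \<in> N}"
  proof (intro radial_measure.intro radial_measure_axioms.intro)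
    show "finite_measure \<kappa>"
      by (rule finite_measureI) (simp add: em sets_eq_imp_space_eq[OF sets] ennreal_mult_eq_top_iff emeasure_finite)
    have "{r. r / z \<le> 0} = {..0}" using z by (auto simp: divide_le_0_iff)
    then show "emeasure \<kappa> {..0} = 0" by (simp add: em nonpos)
    have "{r. r / z = x} = {x * z}" for x using z by (auto simp: field_simps)
    then show "emeasure \<kappa> {x} = 0" for x by (simp add: em atomless)
    show bor: "{r. z * r \<in> N} \<in> sets borel" by measurable
    have "negligible N" using N_null by (simp add: negligible_iff_null_sets null_sets_def)
    then have "negligible ((\<lambda>r. r / z) ` N)"
      by (rule negligible_differentiable_image_negligible[OF order_refl])
        (use z in \<open>auto intro!: derivative_intros simp: divide_inverse\<close>)
    moreover have "(\<lambda>r. r / z) ` N = {r. z * r \<in> N}"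
      using z by (force simp: image_iff)
    ultimately show "emeasure lborel {r. z * r \<in> N} = 0"
      using bor by (simp add: negligible_iff_null_sets null_sets_def)
    have "{r. r / z \<in> - {r. z * r \<in> N}} = - N" using z by auto
    then show "emeasure \<kappa> (- {r. z * r \<in> N}) = 0"
      using bor N_conc by (subst em) auto
    show "0 < emeasure \<kappa> {a<..<b}" if ab: "0 \<le> a" "a < b" for a b
    proof -
      have "{r. r / z \<in> {a<..<b}} = {a * z<..<b * z}" using z by (auto simp: field_simps)
      moreover have "0 < emeasure \<nu> {a * z<..<b * z}" using z ab by (intro full) auto
      ultimately show ?thesis using c by (simp add: em ennreal_zero_less_mult_iff)
    qed
    show "integrable \<kappa> (\<lambda>r. \<bar>r\<bar> ^ m)"
      unfolding \<kappa>_def using c z moment by (simp add: integrable_density integrable_distr_eq power_divide)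
  qed (use m in auto)
qed

lemma exists_normalized:
  obtains \<kappa> N' where "normalized_radial_measure \<kappa> m N'"
proof -
  have pos: "0 < g m 0" by (rule g_pos) auto
  have "\<forall>\<^sub>F z in at_top. g m z < g m 0 / 2"
    using pos by (intro order_tendstoD(2)[OF g_tendsto_0]) simp
  then obtain b where b: "g m b < g m 0 / 2" "0 \<le> b"
    using eventually_happens'[OF _ eventually_conj[OF _ eventually_ge_at_top[of 0]]] by force
  have "\<exists>z. 0 \<le> z \<and> z \<le> b \<and> g m z = g m 0 / 2"
    using b pos by (intro IVT2) (auto simp: isCont_g)
  then obtain z where z: "0 \<le> z" "g m z = g m 0 / 2" by blast
  with pos have "0 < z" by (cases "z = 0") auto
  \<comment> \<open>The new generator at y is c / z^m times \<open>g m (z * y)\<close>. This c makes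
    it 1 at 0, and then the choice of z as half-value point makes it 1/2 at 1.\<close>
  define c where "c = z ^ m / g m 0"
  have "0 < c" using \<open>0 < z\<close> pos by (simp add: c_def)
  define \<kappa> where "\<kappa> = density (distr \<nu> borel (\<lambda>r. r / z)) (\<lambda>_. ennreal c)"
  interpret \<kappa>: radial_measure \<kappa> m "{r. z * r \<in> N}"
    unfolding \<kappa>_def by (rule dilation(1)) fact+
  have "\<kappa>.g m y = c / z ^ m * g m (z * y)" for y
    unfolding \<kappa>.g_def unfolding \<kappa>_def by (rule dilation(2)) fact+
  then have "normalized_radial_measure \<kappa> m {r. z * r \<in> N}"
    using pos \<open>0 < z\<close> z(2) by unfold_locales (simp_all add: c_def)
  then show thesis by (rule that)
qed

end

section \<open>The copula of a radial measure\<close>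

lemma coordinate_sum_measurable [measurable]:
  fixes x :: "'a \<Rightarrow> nat \<Rightarrow> real"
  assumes "x \<in> M \<rightarrow>\<^sub>M PiM {..<n} (\<lambda>_. borel)"
  shows "(\<lambda>p. sum (x p) {..<n}) \<in> borel_measurable M"
  by (rule borel_measurable_sum) (use assms in measurable)

lemma nn_integral_tpow_shift:
  "(\<integral>\<^sup>+y. indicator {a..} y * ennreal (tpow n (s - y)) \<partial>lborel) = ennreal (tpow (Suc n) (s - a))"
proof (cases "a \<le> s")
  case True
  have "(\<integral>\<^sup>+y. indicator {a..} y * ennreal (tpow n (s - y)) \<partial>lborel)
      = (\<integral>\<^sup>+y. ennreal ((s - y) ^ n / fact n) * indicator {a..s} y \<partial>lborel)"
    by (intro nn_integral_cong) (auto simp: tpow_def indicator_def)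
  also have "\<dots> = ennreal (- ((s - s) ^ Suc n / fact (Suc n)) - - ((s - a) ^ Suc n / fact (Suc n)))"
  proof (rule nn_integral_FTC_Icc[where F = "\<lambda>y. - ((s - y) ^ Suc n / fact (Suc n))"])
    have f: "fact (Suc n) = real (Suc n) * fact n" by (rule fact_Suc)
    show "((\<lambda>y. - ((s - y) ^ Suc n / fact (Suc n))) has_real_derivative (s - y) ^ n / fact n) (at y)" for y
      unfolding f by (auto intro!: derivative_eq_intros simp del: of_nat_Suc power_Suc)
  qed (use True in auto)
  finally show ?thesis using True by (simp add: tpow_def del: fact_Suc)
next
  case False
  then have "(\<integral>\<^sup>+y. indicator {a..} y * ennreal (tpow n (s - y)) \<partial>lborel) = (\<integral>\<^sup>+y. 0 \<partial>(lborel :: real measure))"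
    by (intro nn_integral_cong) (auto simp: tpow_def indicator_def)
  then show ?thesis using False by (simp add: tpow_def)
qed

text \<open>Fixing the last coordinate y leaves a simplex of one dimension less with bound s - y,
  and integrating its volume over y \<ge> a_n raises the truncated power by one. In dimension 0 the
  space is a single point of mass 1, which matches \<open>tpow 0\<close> being 1 at 0.\<close>

lemma corner_simplex_volume:
  fixes a :: "nat \<Rightarrow> real"
  shows "(\<integral>\<^sup>+x. indicator {x. (\<forall>i<n. a i \<le> x i) \<and> (\<Sum>i<n. x i) \<le> s} x \<partial>PiM {..<n} (\<lambda>_. lborel))
      = ennreal (tpow n (s - (\<Sum>i<n. a i)))"
proof (induction n arbitrary: s)
  interpret product_sigma_finite "\<lambda>_::nat. lborel :: real measure" by standard
  case 0
  then show ?case by (simp add: nn_integral_empty tpow_def)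
next
  interpret product_sigma_finite "\<lambda>_::nat. lborel :: real measure" by standard
  case (Suc n)
  let ?A = "\<lambda>n s. {x :: nat \<Rightarrow> real. (\<forall>i<n. a i \<le> x i) \<and> (\<Sum>i<n. x i) \<le> s}"
  have [measurable]: "Measurable.pred (PiM (insert n {..<n}) (\<lambda>_. lborel))
      (\<lambda>x. (\<forall>i\<in>{..<Suc n}. a i \<le> x i) \<and> (\<Sum>i<Suc n. x i) \<le> s)"
    unfolding lessThan_Suc[symmetric] by measurable
  have F: "(\<lambda>x. if (\<forall>i\<in>{..<Suc n}. a i \<le> x i) \<and> (\<Sum>i<Suc n. x i) \<le> s then 1 else 0 :: ennreal)
      \<in> borel_measurable (PiM (insert n {..<n}) (\<lambda>_. lborel))"
    by measurable
  have "(\<integral>\<^sup>+x. indicator (?A (Suc n) s) x \<partial>PiM {..<Suc n} (\<lambda>_. lborel))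
      = (\<integral>\<^sup>+x. (if (\<forall>i\<in>{..<Suc n}. a i \<le> x i) \<and> (\<Sum>i<Suc n. x i) \<le> s then 1 else 0) \<partial>PiM (insert n {..<n}) (\<lambda>_. lborel))"
    unfolding lessThan_Suc[symmetric] by (intro nn_integral_cong) (auto simp: indicator_def)
  also have "\<dots> = (\<integral>\<^sup>+y. (\<integral>\<^sup>+x. (if (\<forall>i\<in>{..<Suc n}. a i \<le> (x(n := y)) i) \<and> (\<Sum>i<Suc n. (x(n := y)) i) \<le> s then 1 else 0)
      \<partial>PiM {..<n} (\<lambda>_. lborel)) \<partial>lborel)"
    by (rule product_nn_integral_insert_rev[OF _ _ F]) simp_all
  also have "\<dots> = (\<integral>\<^sup>+y. (\<integral>\<^sup>+x. indicator {a n..} y * indicator (?A n (s - y)) x \<partial>PiM {..<n} (\<lambda>_. lborel)) \<partial>lborel)"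
    by (intro nn_integral_cong) (auto simp: indicator_def less_Suc_eq algebra_simps split: if_splits)
  also have "\<dots> = (\<integral>\<^sup>+y. indicator {a n..} y * ennreal (tpow n (s - (\<Sum>i<n. a i) - y)) \<partial>lborel)"
  proof (intro nn_integral_cong)
    fix y
    have "(\<lambda>x. if (\<forall>i\<in>{..<n}. a i \<le> x i) \<and> (\<Sum>i<n. x i) \<le> s - y then 1 else 0 :: ennreal)
        \<in> borel_measurable (PiM {..<n} (\<lambda>_. lborel))"
      by measurable
    also have "(\<lambda>x. if (\<forall>i\<in>{..<n}. a i \<le> x i) \<and> (\<Sum>i<n. x i) \<le> s - y then 1 else 0) = indicator (?A n (s - y))"
      by (auto simp: fun_eq_iff indicator_def)
    finally have "(indicator (?A n (s - y)) :: _ \<Rightarrow> ennreal) \<in> borel_measurable (PiM {..<n} (\<lambda>_. lborel :: real measure))" .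
    then show "(\<integral>\<^sup>+x. indicator {a n..} y * indicator (?A n (s - y)) x \<partial>PiM {..<n} (\<lambda>_. lborel))
        = indicator {a n..} y * ennreal (tpow n (s - (\<Sum>i<n. a i) - y))"
      using Suc.IH[of "s - y"] by (subst nn_integral_cmult) (auto simp: algebra_simps)
  qed
  also have "\<dots> = ennreal (tpow (Suc n) (s - (\<Sum>i<Suc n. a i)))"
    by (subst nn_integral_tpow_shift) (simp add: algebra_simps)
  finally show ?case .
qed

section \<open>The law whose distribution function is the copula\<close>

context normalized_radial_measure
begin

abbreviation "L \<equiv> PiM {..<m} (\<lambda>_. lborel :: real measure)"

definition D :: "((nat \<Rightarrow> real) \<times> real) set" where
  "D = {(x, r). (\<forall>i\<in>{..<m}. 0 \<le> x i) \<and> (\<Sum>i<m. x i) \<le> r}"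

definition T :: "(nat \<Rightarrow> real) \<times> real \<Rightarrow> nat \<Rightarrow> real" where
  "T = (\<lambda>(x, r). \<lambda>i\<in>{..<Suc m}. \<psi> (if i < m then x i else r - (\<Sum>j<m. x j)))"

text \<open>No normalising factor is needed: integrating out x leaves the mass
  \<open>tpow m r\<close> at radius r, whose \<nu>-integral is \<psi>(0) = 1.\<close>

definition \<mu> :: "(nat \<Rightarrow> real) measure" where
  "\<mu> = distr (density (L \<Otimes>\<^sub>M \<nu>) (indicator D)) (PiM {..<Suc m} (\<lambda>_. borel)) T"

text \<open>Recovers the radius from the coordinates: S inverts the radial part of \<open>T\<close>
  on \<open>D\<close>. Through \<Phi> it is defined and measurable on the whole product
  space.\<close>

definition S :: "(nat \<Rightarrow> real) \<Rightarrow> real" where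
  "S u = (\<Sum>i<Suc m. \<Phi> (u i))"

lemma D_measurable [measurable]: "Measurable.pred (L \<Otimes>\<^sub>M \<nu>) (\<lambda>p. p \<in> D)"
proof -
  have "(\<lambda>p. p \<in> D) = (\<lambda>p. (\<forall>i\<in>{..<m}. 0 \<le> fst p i) \<and> (\<Sum>i<m. fst p i) \<le> snd p)"
    by (auto simp: D_def)
  then show ?thesis by simp
qed

lemma T_measurable [measurable]: "T \<in> L \<Otimes>\<^sub>M \<nu> \<rightarrow>\<^sub>M PiM {..<Suc m} (\<lambda>_. borel)"
proof -
  have "(\<lambda>p. \<psi> (if i < m then fst p i else snd p - (\<Sum>j<m. fst p j))) \<in> L \<Otimes>\<^sub>M \<nu> \<rightarrow>\<^sub>M borel" for i
    by (cases "i < m") simp_all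
  then show ?thesis
    unfolding T_def case_prod_beta by (intro measurable_restrict) auto
qed

lemma S_measurable [measurable]: "S \<in> PiM {..<Suc m} (\<lambda>_. borel) \<rightarrow>\<^sub>M borel"
  unfolding S_def by measurable

lemma sets_mu [simp, measurable_cong]: "sets \<mu> = sets (PiM {..<Suc m} (\<lambda>_. borel))"
  and space_mu [simp]: "space \<mu> = PiE {..<Suc m} (\<lambda>_. UNIV)"
  by (auto simp: \<mu>_def space_PiM)

sublocale Lnu: pair_sigma_finite L \<nu>
proof -
  interpret product_sigma_finite "\<lambda>_::nat. lborel :: real measure" by standard
  show "pair_sigma_finite L \<nu>"
    by (intro pair_sigma_finite.intro sigma_finite sigma_finite_measure_axioms) simp
qed

text \<open>The order with r inside serves null sets and conditional laws, the one with x inside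
  serves quantities that depend on the radius or have simplices as sections.\<close>

lemma nn_integral_mu:
  assumes [measurable]: "f \<in> borel_measurable (PiM {..<Suc m} (\<lambda>_. borel))"
  shows "(\<integral>\<^sup>+u. f u \<partial>\<mu>) = (\<integral>\<^sup>+x. \<integral>\<^sup>+r. indicator D (x, r) * f (T (x, r)) \<partial>\<nu> \<partial>L)"
    and "(\<integral>\<^sup>+u. f u \<partial>\<mu>) = (\<integral>\<^sup>+r. \<integral>\<^sup>+x. indicator D (x, r) * f (T (x, r)) \<partial>L \<partial>\<nu>)"
proof -
  have "(\<integral>\<^sup>+u. f u \<partial>\<mu>) = (\<integral>\<^sup>+p. indicator D p * f (T p) \<partial>(L \<Otimes>\<^sub>M \<nu>))"
    unfolding \<mu>_def by (simp add: nn_integral_distr nn_integral_density)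
  moreover have [measurable]: "(\<lambda>p. indicator D p * f (T p)) \<in> borel_measurable (L \<Otimes>\<^sub>M \<nu>)"
    by measurable
  ultimately show "(\<integral>\<^sup>+u. f u \<partial>\<mu>) = (\<integral>\<^sup>+x. \<integral>\<^sup>+r. indicator D (x, r) * f (T (x, r)) \<partial>\<nu> \<partial>L)"
    "(\<integral>\<^sup>+u. f u \<partial>\<mu>) = (\<integral>\<^sup>+r. \<integral>\<^sup>+x. indicator D (x, r) * f (T (x, r)) \<partial>L \<partial>\<nu>)"
    using nn_integral_fst[of "\<lambda>p. indicator D p * f (T p)" L] Lnu.nn_integral_snd[of "\<lambda>p. indicator D p * f (T p)"]
    by simp_all
qed

lemma emeasure_mu:
  assumes "B \<in> sets (PiM {..<Suc m} (\<lambda>_. borel))"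
  shows "emeasure \<mu> B = (\<integral>\<^sup>+x. \<integral>\<^sup>+r. indicator D (x, r) * indicator B (T (x, r)) \<partial>\<nu> \<partial>L)"
    and "emeasure \<mu> B = (\<integral>\<^sup>+r. \<integral>\<^sup>+x. indicator D (x, r) * indicator B (T (x, r)) \<partial>L \<partial>\<nu>)"
  using nn_integral_mu[of "indicator B"] assms by (simp_all add: nn_integral_indicator[symmetric] del: nn_integral_indicator)

lemma T_in_space: "T p \<in> PiE {..<Suc m} (\<lambda>_. UNIV)"
  by (auto simp: T_def case_prod_beta)

lemma D_coord_nonneg: "(x, r) \<in> D \<Longrightarrow> 0 \<le> (if i < m then x i else r - (\<Sum>j<m. x j))"
  by (auto simp: D_def)

lemma T_range:
  assumes "(x, r) \<in> D" "i < Suc m"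
  shows "0 < T (x, r) i" "T (x, r) i \<le> 1"
  using D_coord_nonneg[OF assms(1), of i] assms(2) by (auto simp: T_def psi_pos psi_le_1)

lemma Phi_T: "(x, r) \<in> D \<Longrightarrow> i < Suc m \<Longrightarrow> \<Phi> (T (x, r) i) = (if i < m then x i else r - (\<Sum>j<m. x j))"
  using D_coord_nonneg[of x r i] by (auto simp: T_def)

lemma S_T: "(x, r) \<in> D \<Longrightarrow> S (T (x, r)) = r"
  unfolding S_def by (simp add: Phi_T)

lemma D_radius_nonneg: "(x, r) \<in> D \<Longrightarrow> 0 \<le> r"
  unfolding D_def by (auto intro: order_trans[OF sum_nonneg])

lemma arch_copula_eq:
  assumes "\<And>i. i < Suc m \<Longrightarrow> 0 < u i" "\<And>i. i < Suc m \<Longrightarrow> u i \<le> 1"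
  shows "arch_copula (Suc m) \<psi> u = \<psi> (S u)"
proof -
  have "(\<Sum>i<Suc m. \<phi> (min (u i) 1)) = S u"
    unfolding S_def using assms by (intro sum.cong) (auto simp: \<Phi>_def min_def)
  moreover have "\<not> (\<exists>i<Suc m. u i \<le> 0)" using assms(1) by (auto simp: not_le)
  ultimately show ?thesis unfolding arch_copula_def by (simp only: if_False)
qed

lemma arch_copula_T: "(x, r) \<in> D \<Longrightarrow> arch_copula (Suc m) \<psi> (T (x, r)) = \<psi> r"
  by (simp add: arch_copula_eq T_range S_T)

lemma arch_copula_measurable [measurable]:
  "arch_copula (Suc m) \<psi> \<in> borel_measurable (PiM {..<Suc m} (\<lambda>_. borel))"
proof -
  have "arch_copula (Suc m) \<psi> = (\<lambda>u. if \<exists>i\<in>{..<Suc m}. u i \<le> 0 then 0 else \<psi> (S (\<lambda>i\<in>{..<Suc m}. min (u i) 1)))"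
  proof
    fix u :: "nat \<Rightarrow> real"
    show "arch_copula (Suc m) \<psi> u = (if \<exists>i\<in>{..<Suc m}. u i \<le> 0 then 0 else \<psi> (S (\<lambda>i\<in>{..<Suc m}. min (u i) 1)))"
    proof (cases "\<exists>i\<in>{..<Suc m}. u i \<le> 0")
      case False
      then have "(\<Sum>i<Suc m. \<phi> (min (u i) 1)) = S (\<lambda>i\<in>{..<Suc m}. min (u i) 1)"
        unfolding S_def by (intro sum.cong) (auto simp: \<Phi>_def not_le)
      moreover have "\<not> (\<exists>i<Suc m. u i \<le> 0)" using False by auto
      ultimately show ?thesis using False unfolding arch_copula_def by (simp only: if_False)
    qed (auto simp: arch_copula_def)
  qed
  then show ?thesis by simp
qed

lemma D_slice_volume: "(\<integral>\<^sup>+x. indicator D (x, r) \<partial>L) = ennreal (tpow m r)"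
proof -
  have "(\<integral>\<^sup>+x. indicator D (x, r) \<partial>L)
      = (\<integral>\<^sup>+x. indicator {x. (\<forall>i<m. 0 \<le> x i) \<and> (\<Sum>i<m. x i) \<le> r} x \<partial>L)"
    by (intro nn_integral_cong) (auto simp: D_def indicator_def)
  then show ?thesis using corner_simplex_volume[where a = "\<lambda>_. 0" and n = m and s = r] by simp
qed

lemma D_slice_measurable: "(\<lambda>x. indicator D (x, r) :: ennreal) \<in> borel_measurable L"
  by measurable

lemma nn_integral_mu_radial:
  assumes "h \<in> borel_measurable (PiM {..<Suc m} (\<lambda>_. borel))"
    and "\<And>x r. (x, r) \<in> D \<Longrightarrow> h (T (x, r)) = f r"
  shows "(\<integral>\<^sup>+u. h u \<partial>\<mu>) = (\<integral>\<^sup>+r. ennreal (tpow m r) * f r \<partial>\<nu>)"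
proof -
  have "(\<integral>\<^sup>+u. h u \<partial>\<mu>) = (\<integral>\<^sup>+r. \<integral>\<^sup>+x. indicator D (x, r) * f r \<partial>L \<partial>\<nu>)"
    unfolding nn_integral_mu(2)[OF assms(1)]
    by (intro nn_integral_cong) (auto simp: indicator_def assms(2))
  also have "\<dots> = (\<integral>\<^sup>+r. ennreal (tpow m r) * f r \<partial>\<nu>)"
    by (intro nn_integral_cong) (simp add: nn_integral_multc D_slice_volume D_slice_measurable)
  finally show ?thesis .
qed

text \<open>For each fixed x the inner integral over r already vanishes, so the infinite Lebesgue
  measure outside does no harm. Absence of atoms, null level sets, the carrier of the law and its
  confinement to the cube all reduce to a \<nu>-null set of radii.\<close>

lemma mu_null:
  assumes B: "B \<in> sets (PiM {..<Suc m} (\<lambda>_. borel))" and Z: "Z \<in> sets borel" "emeasure \<nu> Z = 0"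
    and "\<And>x r. (x, r) \<in> D \<Longrightarrow> T (x, r) \<in> B \<Longrightarrow> r \<in> Z"
  shows "emeasure \<mu> B = 0"
proof -
  have "emeasure \<mu> B \<le> (\<integral>\<^sup>+x. \<integral>\<^sup>+r. indicator Z r \<partial>\<nu> \<partial>L)"
    unfolding emeasure_mu(1)[OF B] using assms(4)
    by (intro nn_integral_mono) (auto simp: indicator_def)
  also have "\<dots> = 0" using Z by simp
  finally show ?thesis by simp
qed

lemma nn_integral_tpow_psi: "(\<integral>\<^sup>+r. ennreal (tpow m (r - z)) \<partial>\<nu>) = ennreal (\<psi> z)"
  unfolding \<psi>_def g_def by (intro nn_integral_eq_integral integrable_tpow) auto

lemma prob_space_mu: "prob_space \<mu>"
proof
  have "emeasure \<mu> (space \<mu>) = (\<integral>\<^sup>+u. 1 \<partial>\<mu>)" by simp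
  also have "\<dots> = (\<integral>\<^sup>+r. ennreal (tpow m (r - 0)) * 1 \<partial>\<nu>)"
    using nn_integral_mu_radial[of "\<lambda>_. 1" "\<lambda>_. 1"] by simp
  also have "\<dots> = 1"
    unfolding mult_1_right nn_integral_tpow_psi by simp
  finally show "emeasure \<mu> (space \<mu>) = 1" .
qed

sublocale mu: prob_space \<mu> by (rule prob_space_mu)

lemma box_sets:
  assumes "\<And>i. i < Suc m \<Longrightarrow> A i \<in> sets borel"
  shows "PiE {..<Suc m} A \<in> sets (PiM {..<Suc m} (\<lambda>_. borel :: real measure))"
  using assms by (intro sets_PiM_I_finite) auto

lemma mu_cube: "emeasure \<mu> (unit_cube (Suc m)) = 1"
proof -
  have "emeasure \<mu> (space \<mu> - unit_cube (Suc m)) = 0"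
  proof (rule mu_null[of _ "{}"])
    show "space \<mu> - unit_cube (Suc m) \<in> sets (PiM {..<Suc m} (\<lambda>_. borel))"
      unfolding sets_mu[symmetric] by (intro sets.Diff sets.top) (simp add: box_sets)
    fix x r assume "(x, r) \<in> D" "T (x, r) \<in> space \<mu> - unit_cube (Suc m)"
    then show "r \<in> {}" using T_range[of x r] by (auto simp: PiE_iff less_imp_le)
  qed auto
  then show ?thesis
    using mu.prob_compl[of "unit_cube (Suc m)"] by (simp add: box_sets mu.emeasure_eq_measure)
qed

text \<open>The law has coordinates in (0, 1], so boxes beyond the cube are null. For a box around a
  point of the cube, a small product of a Lebesgue box \<open>X\<close> and an interval
  \<open>R\<close> of radii is found that \<open>T\<close> maps into it.\<close>

lemma mu_support: "measure_support (Suc m) \<mu> = unit_cube (Suc m)"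
proof (intro subset_antisym subsetI)
  fix x assume x: "x \<in> measure_support (Suc m) \<mu>"
  then have sp: "x \<in> PiE {..<Suc m} (\<lambda>_. UNIV)" and
    pos: "\<And>e. 0 < e \<Longrightarrow> 0 < emeasure \<mu> (PiE {..<Suc m} (\<lambda>i. {x i - e <..< x i + e}))"
    by (auto simp: measure_support_def)
  show "x \<in> unit_cube (Suc m)"
  proof (rule ccontr)
    assume "x \<notin> unit_cube (Suc m)"
    then obtain i where i: "i < Suc m" "x i < 0 \<or> 1 < x i"
      using sp by (auto simp: PiE_iff not_le)
    define e where "e = (if x i < 0 then - x i else x i - 1)"
    have "0 < e" using i by (auto simp: e_def)
    have "emeasure \<mu> (PiE {..<Suc m} (\<lambda>i. {x i - e <..< x i + e})) = 0"
    proof (rule mu_null[of _ "{}"])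
      fix y r assume D: "(y, r) \<in> D" "T (y, r) \<in> PiE {..<Suc m} (\<lambda>i. {x i - e <..< x i + e})"
      have "T (y, r) i \<in> {x i - e <..< x i + e}" using PiE_mem[OF D(2), of i] i by simp
      then show "r \<in> {}" using T_range[OF D(1) i(1)] i by (auto simp: e_def split: if_splits)
    qed (auto intro: box_sets)
    then show False using pos[OF \<open>0 < e\<close>] by simp
  qed
next
  fix x assume x: "x \<in> unit_cube (Suc m)"
  have "0 < emeasure \<mu> (PiE {..<Suc m} (\<lambda>i. {x i - e <..< x i + e}))" if e: "0 < e" for e
  proof -
    let ?B = "PiE {..<Suc m} (\<lambda>i. {x i - e <..< x i + e})"
    \<comment> \<open>The box is cut down to the unit interval, and b < c are taken strictly inside
      it, also when x lies on the boundary; both values lie in (0, 1) and have preimages under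
      \<psi>.\<close>
    define lo hi where "lo i = max (x i - e) 0" and "hi i = min (x i + e) 1" for i
    define c where "c i = (lo i + hi i) / 2" for i
    define b where "b i = (lo i + c i) / 2" for i
    have lohi: "0 \<le> lo i" "lo i < b i" "b i < c i" "c i < 1" "x i - e \<le> lo i" "c i < x i + e" if "i < Suc m" for i
    proof -
      have "0 \<le> x i" "x i \<le> 1" using x that by (auto simp: PiE_iff)
      then have "0 \<le> lo i" "lo i < hi i" "hi i \<le> 1" "x i - e \<le> lo i" "hi i \<le> x i + e"
        using e by (auto simp: lo_def hi_def)
      then show "0 \<le> lo i" "lo i < b i" "b i < c i" "c i < 1" "x i - e \<le> lo i" "c i < x i + e"
        by (auto simp: b_def c_def)
    qed
    define \<alpha> \<beta> where "\<alpha> i = \<Phi> (c i)" and "\<beta> i = \<Phi> (b i)" for i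
    have psi_ab: "\<psi> (\<alpha> i) = c i" "\<psi> (\<beta> i) = b i" "0 \<le> \<alpha> i" "\<alpha> i < \<beta> i" if "i < Suc m" for i
    proof -
      show "\<psi> (\<alpha> i) = c i" "\<psi> (\<beta> i) = b i" "0 \<le> \<alpha> i"
        using lohi[OF that] by (auto simp: \<alpha>_def \<beta>_def \<Phi>_def psi_phi phi_nonneg)
      then show "\<alpha> i < \<beta> i"
        using lohi[OF that] psi_anti[of "\<beta> i" "\<alpha> i"] by force
    qed
    \<comment> \<open>The division by m + 1 leaves room for all coordinates at once: m of them move
      the sum by at most m\<delta>, and the radius varies in a window of width \<delta>, so the last
      coordinate stays between \<alpha>_m and \<alpha>_m + (m+1)\<delta> \<le> \<beta>_m.\<close>
    define \<delta> where "\<delta> = Min ((\<lambda>i. \<beta> i - \<alpha> i) ` {..<Suc m}) / real (Suc m)"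
    have "0 < Min ((\<lambda>i. \<beta> i - \<alpha> i) ` {..<Suc m})"
      using psi_ab(4) by (subst Min_gr_iff) auto
    then have \<delta>: "0 < \<delta>" unfolding \<delta>_def by (intro divide_pos_pos) auto
    have \<delta>_le: "real (Suc m) * \<delta> \<le> \<beta> i - \<alpha> i" if "i < Suc m" for i
    proof -
      have "Min ((\<lambda>i. \<beta> i - \<alpha> i) ` {..<Suc m}) \<le> \<beta> i - \<alpha> i"
        using that by (intro Min_le) auto
      then show ?thesis by (simp add: \<delta>_def del: of_nat_Suc)
    qed
    define A where "A = (\<Sum>i<m. \<alpha> i)"
    define R where "R = {A + \<alpha> m + real m * \<delta> <..< A + \<alpha> m + real (Suc m) * \<delta>}"
    define X where "X = PiE {..<m} (\<lambda>i. {\<alpha> i .. \<alpha> i + \<delta>})"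
    have sub: "(y, r) \<in> D \<and> T (y, r) \<in> ?B" if y: "y \<in> X" and r: "r \<in> R" for y r
    proof -
      have yi: "\<alpha> i \<le> y i" "y i \<le> \<alpha> i + \<delta>" if "i < m" for i
        using PiE_mem[OF y[unfolded X_def], of i] that by simp_all
      have s: "A \<le> (\<Sum>i<m. y i)" "(\<Sum>i<m. y i) \<le> A + real m * \<delta>"
      proof -
        show "A \<le> (\<Sum>i<m. y i)" unfolding A_def using yi by (intro sum_mono) auto
        have "(\<Sum>i<m. y i) \<le> (\<Sum>i<m. \<alpha> i + \<delta>)" using yi by (intro sum_mono) auto
        then show "(\<Sum>i<m. y i) \<le> A + real m * \<delta>" by (simp add: A_def sum.distrib)
      qed
      let ?z = "\<lambda>i. if i < m then y i else r - (\<Sum>j<m. y j)"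
      have z: "\<alpha> i \<le> ?z i" "?z i \<le> \<beta> i" if i: "i < Suc m" for i
      proof -
        have "\<delta> \<le> real (Suc m) * \<delta>" using \<delta> by simp
        then have "\<alpha> i + \<delta> \<le> \<beta> i" using \<delta>_le[OF i] by linarith
        moreover have "\<alpha> m + real (Suc m) * \<delta> \<le> \<beta> m" using \<delta>_le[of m] by simp
        ultimately have "\<alpha> i \<le> ?z i \<and> ?z i \<le> \<beta> i"
          using yi[of i] s r i by (auto simp: R_def less_Suc_eq)
        then show "\<alpha> i \<le> ?z i" "?z i \<le> \<beta> i" by blast+
      qed
      have "(y, r) \<in> D"
      proof -
        have "0 \<le> ?z i" if "i < Suc m" for i
          using z(1)[OF that] psi_ab(3)[OF that] by linarith
        from this[of m] this[OF less_SucI] show ?thesis by (auto simp: D_def split: if_splits)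
      qed
      moreover have "T (y, r) \<in> ?B"
      proof (rule PiE_I)
        fix i assume "i \<in> {..<Suc m}"
        then have i: "i < Suc m" by simp
        have "T (y, r) i = \<psi> (?z i)" using i by (simp add: T_def)
        moreover have "\<psi> (?z i) \<le> c i" "b i \<le> \<psi> (?z i)"
          using psi_anti[OF z(1)[OF i]] psi_anti[OF z(2)[OF i]] psi_ab[OF i] by simp_all
        ultimately show "T (y, r) i \<in> {x i - e <..< x i + e}"
          using lohi[OF i] by simp
      qed (simp add: T_def)
      ultimately show ?thesis by simp
    qed
    interpret product_sigma_finite "\<lambda>_::nat. lborel :: real measure" by standard
    have X: "X \<in> sets L" unfolding X_def by (intro sets_PiM_I_finite) auto
    have "emeasure L X = (\<Prod>i<m. emeasure lborel {\<alpha> i .. \<alpha> i + \<delta>})"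
      unfolding X_def by (rule emeasure_PiM) auto
    also have "\<dots> = (\<Prod>i<m. ennreal \<delta>)"
      using \<delta> by (intro prod.cong) auto
    finally have LX: "0 < emeasure L X" using \<delta> by (simp add: prod_ennreal ennreal_power zero_less_power)
    have "0 \<le> A" unfolding A_def using psi_ab(3) by (intro sum_nonneg) auto
    then have nR: "0 < emeasure \<nu> R"
      unfolding R_def using psi_ab(3)[of m] \<delta> by (intro full) (auto simp: algebra_simps)
    have "0 < emeasure L X * emeasure \<nu> R"
      using LX nR by (simp add: ennreal_zero_less_mult_iff)
    also have "\<dots> = (\<integral>\<^sup>+y. \<integral>\<^sup>+r. indicator X y * indicator R r \<partial>\<nu> \<partial>L)"
      using X by (simp add: nn_integral_cmult nn_integral_multc R_def)
    also have "\<dots> \<le> (\<integral>\<^sup>+y. \<integral>\<^sup>+r. indicator D (y, r) * indicator ?B (T (y, r)) \<partial>\<nu> \<partial>L)"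
      using sub by (intro nn_integral_mono) (auto simp: indicator_def)
    also have "\<dots> = emeasure \<mu> ?B"
      by (intro emeasure_mu(1)[symmetric] box_sets) simp
    finally show ?thesis .
  qed
  moreover have "x \<in> PiE {..<Suc m} (\<lambda>_. UNIV)" using x by (auto simp: PiE_iff)
  ultimately show "x \<in> measure_support (Suc m) \<mu>" by (simp add: measure_support_def)
qed

lemma copula_measure_mu: "copula_measure (Suc m) (arch_copula (Suc m) \<psi>) \<mu>"
  unfolding copula_measure_def
proof (intro conjI ballI)
  show "prob_space \<mu>" by (rule prob_space_mu)
  show "emeasure \<mu> (unit_cube (Suc m)) = 1" by (rule mu_cube)
  fix u assume u: "u \<in> unit_cube (Suc m)"
  let ?B = "PiE {..<Suc m} (\<lambda>i. {0..u i})"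
  have B: "?B \<in> sets (PiM {..<Suc m} (\<lambda>_. borel))" by (rule box_sets) simp
  show "measure \<mu> ?B = arch_copula (Suc m) \<psi> u"
  proof (cases "\<exists>i<Suc m. u i \<le> 0")
    case True
    then obtain i where i: "i < Suc m" "u i \<le> 0" by blast
    \<comment> \<open>The coordinates of \<open>T\<close> are positive on \<open>D\<close>, so these
      boxes are null, in agreement with the value 0 of \<open>arch_copula\<close>.\<close>
    have "emeasure \<mu> ?B = 0"
    proof (rule mu_null[OF B, of "{}"])
      fix x r assume D: "(x, r) \<in> D" "T (x, r) \<in> ?B"
      have "T (x, r) i \<le> u i" using PiE_mem[OF D(2), of i] i by simp
      then show "r \<in> {}" using T_range[OF D(1) i(1)] i by simp
    qed auto
    then show ?thesis using True by (simp add: arch_copula_def measure_def)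
  next
    case False
    then have ui: "0 < u i" "u i \<le> 1" if "i < Suc m" for i using u that by (auto simp: PiE_iff not_le)
    have Phi: "0 \<le> \<Phi> (u i)" "0 \<le> z \<Longrightarrow> \<psi> z \<le> u i \<longleftrightarrow> \<Phi> (u i) \<le> z" if "i < Suc m" for i z
      using ui[OF that] by (auto simp: phi_nonneg psi_le_iff_phi \<Phi>_def)
    \<comment> \<open>In terms of x and r the box is a corner simplex; membership in
      \<open>D\<close> comes for free because \<Phi> is nonnegative.\<close>
    have iff: "(x, r) \<in> D \<and> T (x, r) \<in> ?B \<longleftrightarrow>
        (\<forall>i<m. \<Phi> (u i) \<le> x i) \<and> (\<Sum>i<m. x i) \<le> r - \<Phi> (u m)" for x r
    proof
      assume D: "(x, r) \<in> D \<and> T (x, r) \<in> ?B"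
      let ?z = "\<lambda>i. if i < m then x i else r - (\<Sum>j<m. x j)"
      have "\<Phi> (u i) \<le> ?z i" if i: "i < Suc m" for i
      proof -
        have "T (x, r) i \<le> u i" using PiE_mem[OF conjunct2[OF D], of i] i by simp
        then have "\<psi> (?z i) \<le> u i" using i by (simp add: T_def)
        then show ?thesis using Phi(2)[OF i D_coord_nonneg, of x r] D by blast
      qed
      from this[of m] this[OF less_SucI] show "(\<forall>i<m. \<Phi> (u i) \<le> x i) \<and> (\<Sum>i<m. x i) \<le> r - \<Phi> (u m)"
        by (auto split: if_splits)
    next
      assume A: "(\<forall>i<m. \<Phi> (u i) \<le> x i) \<and> (\<Sum>i<m. x i) \<le> r - \<Phi> (u m)"
      then have D: "(x, r) \<in> D"
        using Phi_nonneg[of "u m"] order_trans[OF Phi_nonneg] by (auto simp: D_def)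
      have "T (x, r) i \<le> u i" if i: "i < Suc m" for i
      proof -
        have "\<Phi> (u i) \<le> (if i < m then x i else r - (\<Sum>j<m. x j))"
          using A i by (auto simp: less_Suc_eq)
        then show ?thesis using Phi(2)[OF i D_coord_nonneg[OF D]] i by (simp add: T_def)
      qed
      then show "(x, r) \<in> D \<and> T (x, r) \<in> ?B"
        using D T_range[OF D] T_in_space[of "(x, r)"] by (auto simp: PiE_iff less_imp_le)
    qed
    have "emeasure \<mu> ?B = (\<integral>\<^sup>+r. \<integral>\<^sup>+x. indicator D (x, r) * indicator ?B (T (x, r)) \<partial>L \<partial>\<nu>)"
      by (rule emeasure_mu(2)[OF B])
    also have "\<dots> = (\<integral>\<^sup>+r. \<integral>\<^sup>+x. indicator {x. (\<forall>i<m. \<Phi> (u i) \<le> x i) \<and> (\<Sum>i<m. x i) \<le> r - \<Phi> (u m)} x \<partial>L \<partial>\<nu>)"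
      by (intro nn_integral_cong) (simp add: indicator_def iff[symmetric])
    also have "\<dots> = (\<integral>\<^sup>+r. ennreal (tpow m (r - S u)) \<partial>\<nu>)"
      unfolding corner_simplex_volume by (intro nn_integral_cong) (simp add: S_def algebra_simps)
    also have "\<dots> = ennreal (\<psi> (S u))" by (rule nn_integral_tpow_psi)
    finally show ?thesis
      using ui by (simp add: arch_copula_eq measure_def psi_nonneg)
  qed
qed simp

text \<open>The null set consists of the points of (0, 1]^d whose radius S(u) lies in
  \<open>N\<close>. It carries the law because S recovers r, and it is Lebesgue null because every
  fibre in the last coordinate is a set of the kind treated in
  \<open>psi_image_null\<close>.\<close>

lemma mu_singular: "singular_wrt_lebesgue (Suc m) \<mu>"
  unfolding singular_wrt_lebesgue_def
proof (intro bexI conjI)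
  interpret product_sigma_finite "\<lambda>_::nat. lborel :: real measure" by standard
  let ?L = "PiM {..<Suc m} (\<lambda>_. lborel :: real measure)"
  let ?M = "{u \<in> space ?L. (\<forall>i\<in>{..<Suc m}. 0 < u i \<and> u i \<le> 1) \<and> S u \<in> N}"
  have eq: "sets ?L = sets (PiM {..<Suc m} (\<lambda>_. borel))" by (intro sets_PiM_cong) auto
  have [measurable]: "S \<in> borel_measurable ?L"
    using S_measurable by (simp add: measurable_cong_sets[OF eq refl])
  show M: "?M \<in> sets ?L" by measurable
  have L: "PiM (insert m {..<m}) (\<lambda>_. lborel :: real measure) = ?L"
    by (simp add: lessThan_Suc)
  have F: "(indicator ?M :: _ \<Rightarrow> ennreal) \<in> borel_measurable (PiM (insert m {..<m}) (\<lambda>_. lborel))"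
    unfolding L using M by (rule borel_measurable_indicator)
  have "emeasure ?L ?M = (\<integral>\<^sup>+u. indicator ?M u \<partial>PiM (insert m {..<m}) (\<lambda>_. lborel))"
    unfolding L using M by (rule nn_integral_indicator[symmetric])
  also have "\<dots> = (\<integral>\<^sup>+x. \<integral>\<^sup>+y. indicator ?M (x(m := y)) \<partial>lborel \<partial>L)"
    by (rule product_nn_integral_insert[OF _ _ F]) simp_all
  also have "\<dots> \<le> (\<integral>\<^sup>+x. \<integral>\<^sup>+y. indicator {y. 0 < y \<and> y \<le> 1 \<and> (\<Sum>i<m. \<Phi> (x i)) + \<Phi> y \<in> N} y \<partial>lborel \<partial>L)"
    by (intro nn_integral_mono) (simp add: indicator_def S_def, blast)
  also have "\<dots> = 0"
    using psi_image_null by simp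
  finally show "emeasure ?L ?M = 0" by simp
  show "emeasure \<mu> (space \<mu> - ?M) = 0"
  proof (rule mu_null)
    show "space \<mu> - ?M \<in> sets (PiM {..<Suc m} (\<lambda>_. borel))"
      using M unfolding sets_mu[symmetric] by (intro sets.Diff sets.top) (simp add: eq)
    show "- N \<in> sets borel" by simp
    fix x r assume "(x, r) \<in> D" "T (x, r) \<in> space \<mu> - ?M"
    then show "r \<in> - N" using T_range[of x r] by (auto simp: S_T space_PiM)
  qed (rule N_conc)
qed

text \<open>A level pins the radius to a single value, and \<nu> has no atoms. The set A is left
  free so that the cube and single points are both covered.\<close>

lemma mu_level_set_null:
  assumes "{u \<in> A. arch_copula (Suc m) \<psi> u = t} \<in> sets (PiM {..<Suc m} (\<lambda>_. borel))"
  shows "emeasure \<mu> {u \<in> A. arch_copula (Suc m) \<psi> u = t} = 0"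
proof (rule mu_null[OF assms, of "{\<Phi> t}"])
  fix x r assume "(x, r) \<in> D" "T (x, r) \<in> {u \<in> A. arch_copula (Suc m) \<psi> u = t}"
  then have "\<psi> r = t" "0 \<le> r" using arch_copula_T[of x r] D_radius_nonneg[of x r] by auto
  then show "r \<in> {\<Phi> t}" using Phi_psi[of r] by simp
qed (auto simp: atomless)

lemma cube_level_set_sets:
  "{u \<in> unit_cube (Suc m). arch_copula (Suc m) \<psi> u = t} \<in> sets \<mu>"
proof -
  have "unit_cube (Suc m) \<inter> {u \<in> space \<mu>. arch_copula (Suc m) \<psi> u = t} \<in> sets \<mu>"
    by (intro sets.Int) (simp_all add: box_sets)
  also have "unit_cube (Suc m) \<inter> {u \<in> space \<mu>. arch_copula (Suc m) \<psi> u = t}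
      = {u \<in> unit_cube (Suc m). arch_copula (Suc m) \<psi> u = t}"
  proof -
    have "unit_cube (Suc m) \<subseteq> space \<mu>" unfolding space_mu by (rule PiE_mono) simp
    then show ?thesis by blast
  qed
  finally show ?thesis .
qed

text \<open>A point is a measurable part of its own level set.\<close>

lemma mu_atomless:
  assumes "x \<in> space \<mu>"
  shows "{x} \<in> sets \<mu>" "emeasure \<mu> {x} = 0"
proof -
  have "{x} = PiE {..<Suc m} (\<lambda>i. {x i})"
    using assms PiE_singleton[of x "{..<Suc m}"] by (simp add: PiE_iff)
  then show *: "{x} \<in> sets \<mu>" using box_sets[of "\<lambda>i. {x i}"] by simp
  have eq: "{u \<in> {x}. arch_copula (Suc m) \<psi> u = arch_copula (Suc m) \<psi> x} = {x}" by auto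
  show "emeasure \<mu> {x} = 0"
    using mu_level_set_null[of "{x}" "arch_copula (Suc m) \<psi> x"] * unfolding eq by simp
qed

end

section \<open>Kendall distribution and conditional distributions\<close>

lemma right_continuous_eq_rat:
  fixes F G :: "real \<Rightarrow> real"
  assumes "\<And>a. continuous (at_right a) F" "\<And>a. continuous (at_right a) G"
    and eq: "\<And>q::rat. F (of_rat q) = G (of_rat q)"
  shows "F = G"
proof
  fix a
  have lim: "((\<lambda>x. F x - G x) \<longlongrightarrow> F a - G a) (at_right a)"
    using assms(1,2)[of a] by (auto simp: continuous_within intro: tendsto_diff)
  show "F a = G a"
  proof (rule ccontr)
    assume "F a \<noteq> G a"
    then have "\<forall>\<^sub>F x in at_right a. F x - G x \<noteq> 0"
      using lim by (intro tendsto_imp_eventually_ne) auto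
    then obtain b where "a < b" "\<And>y. a < y \<Longrightarrow> y < b \<Longrightarrow> F y - G y \<noteq> 0"
      by (auto simp: eventually_at_right_field)
    moreover obtain q :: rat where "a < of_rat q" "of_rat q < b"
      using of_rat_dense[OF \<open>a < b\<close>] by blast
    ultimately show False using eq by force
  qed
qed

section \<open>Transported radial laws and the Kendall distribution\<close>

context normalized_radial_measure
begin

text \<open>The law of \<psi>(r - s) when r has density f with respect to \<nu>: a common form for
  the Kendall law, with s = 0, and the conditional laws.\<close>

definition transport :: "(real \<Rightarrow> ennreal) \<Rightarrow> real \<Rightarrow> real measure" where
  "transport f s = distr (density \<nu> f) borel (\<lambda>r. \<psi> (r - s))"

lemma sets_transport [simp]: "sets (transport f s) = sets borel"
  and space_transport [simp]: "space (transport f s) = UNIV"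
  by (simp_all add: transport_def)

lemma emeasure_transport:
  assumes [measurable]: "f \<in> borel_measurable borel" "B \<in> sets borel"
  shows "emeasure (transport f s) B = (\<integral>\<^sup>+r. f r * indicator B (\<psi> (r - s)) \<partial>\<nu>)"
proof -
  have "emeasure (transport f s) B = (\<integral>\<^sup>+u. indicator B u \<partial>transport f s)" by simp
  also have "\<dots> = (\<integral>\<^sup>+r. f r * indicator B (\<psi> (r - s)) \<partial>\<nu>)"
    unfolding transport_def by (subst nn_integral_distr) (auto simp: nn_integral_density)
  finally show ?thesis .
qed

lemma transport_null:
  assumes f: "f \<in> borel_measurable borel" "\<And>r. r < s \<Longrightarrow> f r = 0"
    and B: "B \<in> sets borel" and Z: "Z \<in> sets borel" "emeasure \<nu> Z = 0"
    and imp: "\<And>r. s \<le> r \<Longrightarrow> \<psi> (r - s) \<in> B \<Longrightarrow> r \<in> Z"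
  shows "emeasure (transport f s) B = 0"
proof -
  have "AE r in \<nu>. r \<notin> Z" using Z by (intro AE_not_in) (simp add: null_sets_def)
  then have "AE r in \<nu>. f r * indicator B (\<psi> (r - s)) = 0"
  proof eventually_elim
    case (elim r)
    then show ?case using f(2)[of r] imp[of r] by (cases "r < s") (auto simp: indicator_def)
  qed
  then have "(\<integral>\<^sup>+r. f r * indicator B (\<psi> (r - s)) \<partial>\<nu>) = (\<integral>\<^sup>+r. 0 \<partial>\<nu>)"
    by (rule nn_integral_cong_AE)
  then show ?thesis using emeasure_transport[OF f(1) B] by simp
qed

text \<open>Each requirement is pulled back to \<nu> along r \<mapsto> \<psi>(r - s), which is
  invertible for r \<ge> s. This is why f has to vanish below s, and positivity beyond s preserves
  the charge of intervals.\<close>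

lemma cont_strict_singular_transport:
  assumes f [measurable]: "f \<in> borel_measurable borel" and fin: "(\<integral>\<^sup>+r. f r \<partial>\<nu>) < \<infinity>"
    and s: "0 \<le> s" and zero: "\<And>r. r < s \<Longrightarrow> f r = 0" and pos: "\<And>r. s < r \<Longrightarrow> 0 < f r"
  shows "cont_strict_singular (\<lambda>y. measure (transport f s) {0..y})"
proof (rule cont_strict_singular_measure)
  let ?N = "{y. 0 < y \<and> y \<le> 1 \<and> s + \<Phi> y \<in> N}"
  show "finite_measure (transport f s)"
    using fin by (intro finite_measureI) (simp add: emeasure_transport)
  show "?N \<in> sets borel" "emeasure lborel ?N = 0"
    by (rule psi_image_null)+
  then show "emeasure (transport f s) (- ?N) = 0"
    by (intro transport_null[of _ _ _ "- N"]) (auto simp: zero N_conc psi_pos psi_le_1)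
  show "emeasure (transport f s) {..<0} = 0"
  proof (rule transport_null[of _ _ _ "{}"])
    fix r assume "\<psi> (r - s) \<in> {..<0}"
    then show "r \<in> {}" using psi_nonneg[of "r - s"] by simp
  qed (simp_all add: zero)
  show "emeasure (transport f s) {y} = 0" for y
  proof (rule transport_null[of _ _ _ "{s + \<Phi> y}"])
    fix r assume r: "s \<le> r" "\<psi> (r - s) \<in> {y}"
    then show "r \<in> {s + \<Phi> y}" using Phi_psi[of "r - s"] by simp
  qed (auto simp: zero atomless)
  fix a b :: real assume ab: "0 \<le> a" "a < b" "b \<le> 1"
  \<comment> \<open>Both values lie strictly inside (a, b), with 0 < c and e < 1 even if a = 0 or b
    = 1, so they have preimages under \<psi>.\<close>
  define c e where "c = (a + b) / 2" and "e = (c + b) / 2"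
  have ce: "a < c" "c < e" "e < b" "0 < c"
    using ab by (auto simp: c_def e_def)
  then have "e < 1" using ab by linarith
  define \<alpha> \<beta> where "\<alpha> = \<Phi> e" and "\<beta> = \<Phi> c"
  have psi_ab: "\<psi> \<alpha> = e" "\<psi> \<beta> = c" "0 \<le> \<alpha>"
    using ce ab \<open>e < 1\<close> by (auto simp: \<alpha>_def \<beta>_def \<Phi>_def psi_phi phi_nonneg)
  then have lt: "\<alpha> < \<beta>"
    using ce psi_anti[of \<beta> \<alpha>] by force
  show "0 < emeasure (transport f s) {a<..<b}"
  proof (rule ccontr)
    assume "\<not> 0 < emeasure (transport f s) {a<..<b}"
    then have "(\<integral>\<^sup>+r. f r * indicator {a<..<b} (\<psi> (r - s)) \<partial>\<nu>) = 0"
      by (simp add: emeasure_transport)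
    then have "AE r in \<nu>. f r * indicator {a<..<b} (\<psi> (r - s)) = 0"
      by (subst (asm) nn_integral_0_iff_AE) auto
    then have "AE r in \<nu>. r \<notin> {s + \<alpha><..<s + \<beta>}"
    proof eventually_elim
      case (elim r)
      show ?case
      proof
        assume r: "r \<in> {s + \<alpha><..<s + \<beta>}"
        then have "\<psi> (r - s) \<in> {a<..<b}"
          using psi_anti[of \<alpha> "r - s"] psi_anti[of "r - s" \<beta>] psi_ab ce by auto
        moreover have "0 < f r" using r psi_ab by (intro pos) auto
        ultimately show False using elim by (simp add: indicator_def)
      qed
    qed
    then have "emeasure \<nu> {s + \<alpha><..<s + \<beta>} = 0"
      by (subst (asm) AE_iff_measurable[of "{s + \<alpha><..<s + \<beta>}"]) auto
    then show False using full[of "s + \<alpha>" "s + \<beta>"] s psi_ab lt by simp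
  qed
qed simp

lemma kendall_cont_strict_singular:
  "cont_strict_singular (kendall_df \<mu> (arch_copula (Suc m) \<psi>))"
proof -
  have "kendall_df \<mu> (arch_copula (Suc m) \<psi>) = (\<lambda>t. measure (transport (\<lambda>r. ennreal (tpow m r)) 0) {0..t})"
  proof
    fix t
    let ?B = "{u \<in> space \<mu>. arch_copula (Suc m) \<psi> u \<le> t}"
    have B: "?B \<in> sets \<mu>" by measurable
    then have h: "(indicator ?B :: _ \<Rightarrow> ennreal) \<in> borel_measurable (PiM {..<Suc m} (\<lambda>_. borel))"
      by (simp add: borel_measurable_indicator)
    have "emeasure \<mu> ?B = (\<integral>\<^sup>+r. ennreal (tpow m r) * indicator {0..t} (\<psi> r) \<partial>\<nu>)"
    proof (subst nn_integral_indicator[OF B, symmetric], rule nn_integral_mu_radial[OF h])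
      fix x r assume "(x, r) \<in> D"
      then show "indicator ?B (T (x, r)) = (indicator {0..t} (\<psi> r) :: ennreal)"
        using T_in_space[of "(x, r)"] by (simp add: indicator_def arch_copula_T psi_nonneg)
    qed
    then show "kendall_df \<mu> (arch_copula (Suc m) \<psi>) t = measure (transport (\<lambda>r. ennreal (tpow m r)) 0) {0..t}"
      by (simp add: kendall_df_def measure_def emeasure_transport)
  qed
  moreover have "cont_strict_singular (\<lambda>t. measure (transport (\<lambda>r. ennreal (tpow m r)) 0) {0..t})"
    using nn_integral_tpow_psi[of 0]
    by (intro cont_strict_singular_transport) (auto simp: tpow_pos tpow_def)
  ultimately show ?thesis by simp
qed

section \<open>Conditional distributions of the last coordinate\<close>

definition \<sigma> :: "(nat \<Rightarrow> real) \<Rightarrow> real" where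
  "\<sigma> x = (\<Sum>i<m. \<Phi> (x i))"

lemma sigma_measurable [measurable]: "\<sigma> \<in> borel_measurable (PiM {..<m} (\<lambda>_. borel))"
  unfolding \<sigma>_def by measurable

lemma sigma_nonneg: "0 \<le> \<sigma> x"
  unfolding \<sigma>_def by (intro sum_nonneg) (simp add: Phi_nonneg)

definition tail_density :: "real \<Rightarrow> real \<Rightarrow> ennreal" where
  "tail_density s r = ennreal (1 / g 0 s) * indicator {s..} r"

text \<open>The factor \<open>1 / g 0 s\<close> in the density normalises the tail of \<nu> beyond
  s. Since \<sigma> is nonnegative everywhere, this is a probability measure with the desired
  distribution function for every x, not just for almost every x.\<close>

definition K\<^sub>0 :: "(nat \<Rightarrow> real) \<Rightarrow> real measure" where
  "K\<^sub>0 x = transport (tail_density (\<sigma> x)) (\<sigma> x)"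

lemma tail_density_measurable [measurable]:
  "tail_density s \<in> borel_measurable borel"
  unfolding tail_density_def by measurable

lemma emeasure_tail: "0 \<le> s \<Longrightarrow> ennreal (1 / g 0 s) * emeasure \<nu> {s..} = 1"
  using g_pos[of 0 s] by (simp add: emeasure_eq_measure g_0[symmetric] ennreal_mult[symmetric])

lemma prob_space_K0: "prob_space (K\<^sub>0 x)"
proof
  have "emeasure (K\<^sub>0 x) UNIV = (\<integral>\<^sup>+r. ennreal (1 / g 0 (\<sigma> x)) * indicator {\<sigma> x..} r \<partial>\<nu>)"
    unfolding K\<^sub>0_def by (subst emeasure_transport) (auto simp: tail_density_def)
  also have "\<dots> = 1"
    by (simp add: nn_integral_cmult emeasure_tail sigma_nonneg)
  finally show "emeasure (K\<^sub>0 x) (space (K\<^sub>0 x)) = 1" by (simp add: K\<^sub>0_def)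
qed

lemma cont_strict_singular_K0: "cont_strict_singular (\<lambda>y. measure (K\<^sub>0 x) {0..y})"
  unfolding K\<^sub>0_def
proof (rule cont_strict_singular_transport)
  show "(\<integral>\<^sup>+r. tail_density (\<sigma> x) r \<partial>\<nu>) < \<infinity>"
    using emeasure_tail[OF sigma_nonneg[of x]] by (simp add: tail_density_def nn_integral_cmult)
  show "0 < tail_density (\<sigma> x) r" if "\<sigma> x < r" for r
    using that g_pos[of 0 "\<sigma> x"] sigma_nonneg[of x] by (simp add: tail_density_def)
qed (simp_all add: sigma_nonneg tail_density_def)

text \<open>The kernel before normalisation. It depends on x through one real parameter, which
  reduces measurability of the kernel to that of a parameter integral.\<close>

definition tail_mass :: "real set \<Rightarrow> real \<Rightarrow> ennreal" where
  "tail_mass B s = (\<integral>\<^sup>+r. indicator {s..} r * indicator B (\<psi> (r - s)) \<partial>\<nu>)"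

lemma emeasure_K0:
  assumes "B \<in> sets borel"
  shows "emeasure (K\<^sub>0 x) B = ennreal (1 / g 0 (\<sigma> x)) * tail_mass B (\<sigma> x)"
proof -
  have [measurable]: "B \<in> sets borel" by fact
  have "emeasure (K\<^sub>0 x) B = (\<integral>\<^sup>+r. ennreal (1 / g 0 (\<sigma> x)) * (indicator {\<sigma> x..} r * indicator B (\<psi> (r - \<sigma> x))) \<partial>\<nu>)"
    unfolding K\<^sub>0_def emeasure_transport[OF tail_density_measurable assms]
    by (simp add: tail_density_def mult.assoc)
  also have "\<dots> = ennreal (1 / g 0 (\<sigma> x)) * tail_mass B (\<sigma> x)"
    unfolding tail_mass_def by (intro nn_integral_cmult) measurable
  finally show ?thesis .
qed

lemma tail_mass_measurable [measurable]:
  assumes [measurable]: "B \<in> sets borel"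
  shows "tail_mass B \<in> borel_measurable borel"
proof -
  have [measurable]: "(\<lambda>(s, r). (if s \<le> r then 1 else 0) * (indicator B (\<psi> (r - s)) :: ennreal))
      \<in> borel_measurable (borel \<Otimes>\<^sub>M \<nu>)"
    by measurable
  have "tail_mass B = (\<lambda>s. \<integral>\<^sup>+r. (if s \<le> r then 1 else 0) * indicator B (\<psi> (r - s)) \<partial>\<nu>)"
    unfolding tail_mass_def by (intro ext nn_integral_cong) (simp add: indicator_def)
  then show ?thesis by simp
qed

lemma g_0_measurable [measurable]: "g 0 \<in> borel_measurable borel"
  by (intro borel_measurable_continuous_onI) (simp add: continuous_on_eq_continuous_at isCont_g_0)

lemma K0_measurable [measurable]:
  assumes [measurable]: "B \<in> sets borel"
  shows "(\<lambda>x. emeasure (K\<^sub>0 x) B) \<in> borel_measurable (PiM {..<m} (\<lambda>_. borel))"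
  unfolding emeasure_K0[OF assms] by measurable

lemma sigma_restrict_T: "(x, r) \<in> D \<Longrightarrow> \<sigma> (restrict (T (x, r)) {..<m}) = (\<Sum>i<m. x i)"
  unfolding \<sigma>_def by (simp add: Phi_T)

lemma restrict_coordinates_measurable [measurable]:
  "(\<lambda>u. restrict u {..<m}) \<in> PiM {..<Suc m} (\<lambda>_. borel) \<rightarrow>\<^sub>M PiM {..<m} (\<lambda>_. borel)"
  by (rule measurable_restrict_subset) auto

text \<open>Integrating out r turns the left side into a tail mass. On the right the kernel does not
  involve r, so integrating out r yields the mass of [s, \<infinity>), which its normalising factor
  cancels. The right side is kept over \<mu>, with the marginal hidden in the restriction.\<close>

lemma K0_disintegration:
  assumes A: "A \<in> sets (PiM {..<m} (\<lambda>_. borel))" and B: "B \<in> sets borel"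
  shows "emeasure \<mu> {u \<in> space \<mu>. restrict u {..<m} \<in> A \<and> u m \<in> B}
    = (\<integral>\<^sup>+u. indicator A (restrict u {..<m}) * emeasure (K\<^sub>0 (restrict u {..<m})) B \<partial>\<mu>)"
proof -
  have [measurable]: "B \<in> sets borel" "A \<in> sets (PiM {..<m} (\<lambda>_. borel))" by fact+
  define X where "X x = (\<lambda>i\<in>{..<m}. \<psi> (x i))" for x :: "nat \<Rightarrow> real"
  have RT: "restrict (T (x, r)) {..<m} = X x" for x r
    by (auto simp: T_def X_def restrict_def fun_eq_iff)
  have Tm: "T (x, r) m = \<psi> (r - (\<Sum>i<m. x i))" for x r
    by (simp add: T_def)
  \<comment> \<open>The part of the indicator of \<open>D\<close> that is free of r and can be moved
    out of the inner integral.\<close>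
  define p :: "(nat \<Rightarrow> real) \<Rightarrow> ennreal" where "p x = (if \<forall>i\<in>{..<m}. 0 \<le> x i then 1 else 0)" for x
  have Dp: "indicator D (x, r) = p x * indicator {\<Sum>i<m. x i..} r" for x r
    by (auto simp: D_def p_def indicator_def)
  let ?E = "{u \<in> space \<mu>. restrict u {..<m} \<in> A \<and> u m \<in> B}"
  have E: "?E \<in> sets (PiM {..<Suc m} (\<lambda>_. borel))"
    unfolding sets_mu[symmetric] by measurable
  have "emeasure \<mu> ?E = (\<integral>\<^sup>+x. \<integral>\<^sup>+r. indicator D (x, r) * indicator ?E (T (x, r)) \<partial>\<nu> \<partial>L)"
    by (rule emeasure_mu(1)[OF E])
  also have "\<dots> = (\<integral>\<^sup>+x. \<integral>\<^sup>+r. p x * indicator A (X x) * (indicator {\<Sum>i<m. x i..} r * indicator B (\<psi> (r - (\<Sum>i<m. x i)))) \<partial>\<nu> \<partial>L)"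
    unfolding Dp using T_in_space by (intro nn_integral_cong) (simp add: RT Tm indicator_def)
  also have "\<dots> = (\<integral>\<^sup>+x. p x * indicator A (X x) * tail_mass B (\<Sum>i<m. x i) \<partial>L)"
    unfolding tail_mass_def by (intro nn_integral_cong nn_integral_cmult) measurable
  \<comment> \<open>A factor 1 is inserted, as normalising constant times tail mass. This needs a
    nonnegative sum; where a coordinate is negative, \<open>p x\<close> is 0.\<close>
  also have "\<dots> = (\<integral>\<^sup>+x. p x * indicator A (X x) * (ennreal (1 / g 0 (\<Sum>i<m. x i)) * emeasure \<nu> {\<Sum>i<m. x i..}) * tail_mass B (\<Sum>i<m. x i) \<partial>L)"
  proof (intro nn_integral_cong)
    fix x
    show "p x * indicator A (X x) * tail_mass B (\<Sum>i<m. x i)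
      = p x * indicator A (X x) * (ennreal (1 / g 0 (\<Sum>i<m. x i)) * emeasure \<nu> {\<Sum>i<m. x i..}) * tail_mass B (\<Sum>i<m. x i)"
    proof (cases "\<forall>i\<in>{..<m}. 0 \<le> x i")
      case True
      then have "0 \<le> (\<Sum>i<m. x i)" by (intro sum_nonneg) auto
      then show ?thesis by (simp add: emeasure_tail)
    next
      case False
      then have "p x = 0" unfolding p_def by (rule if_not_P)
      then show ?thesis by simp
    qed
  qed
  \<comment> \<open>The tail mass is reopened as an integral over r, which restores the indicator of
    \<open>D\<close> and hence an integral against \<mu>.\<close>
  also have "\<dots> = (\<integral>\<^sup>+x. \<integral>\<^sup>+r. p x * indicator A (X x) * ennreal (1 / g 0 (\<Sum>i<m. x i)) * tail_mass B (\<Sum>i<m. x i) * indicator {\<Sum>i<m. x i..} r \<partial>\<nu> \<partial>L)"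
    by (intro nn_integral_cong, subst nn_integral_cmult) (simp_all add: mult_ac)
  also have "\<dots> = (\<integral>\<^sup>+x. \<integral>\<^sup>+r. indicator D (x, r) * (indicator A (restrict (T (x, r)) {..<m})
      * emeasure (K\<^sub>0 (restrict (T (x, r)) {..<m})) B) \<partial>\<nu> \<partial>L)"
  proof (intro nn_integral_cong)
    fix x r
    show "p x * indicator A (X x) * ennreal (1 / g 0 (\<Sum>i<m. x i)) * tail_mass B (\<Sum>i<m. x i) * indicator {\<Sum>i<m. x i..} r
      = indicator D (x, r) * (indicator A (restrict (T (x, r)) {..<m}) * emeasure (K\<^sub>0 (restrict (T (x, r)) {..<m})) B)"
    proof (cases "(x, r) \<in> D")
      case True
      then have "\<sigma> (X x) = (\<Sum>i<m. x i)" using sigma_restrict_T RT by metis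
      then show ?thesis
        by (simp add: Dp emeasure_K0[OF B] RT mult_ac)
    next
      case False
      then have "p x = 0 \<or> indicator {\<Sum>i<m. x i..} r = (0 :: ennreal)" using Dp[of x r] by simp
      then show ?thesis using False by auto
    qed
  qed
  also have "\<dots> = (\<integral>\<^sup>+u. indicator A (restrict u {..<m}) * emeasure (K\<^sub>0 (restrict u {..<m})) B \<partial>\<mu>)"
    by (rule nn_integral_mu(1)[symmetric]) measurable
  finally show ?thesis .
qed

lemma finite_measure_first_marginal: "finite_measure (first_marginal (Suc m) \<mu>)"
  unfolding first_marginal_def by (intro mu.finite_measure_distr) simp

text \<open>For fixed B both kernels are densities, with respect to the marginal, of the same finite
  measure in A, and densities are unique almost everywhere. The exceptional set may depend on
  B.\<close>

lemma kernel_eq_K0_AE: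
  assumes K: "markov_kernel_of (Suc m) \<mu> K" and B: "B \<in> sets borel"
  shows "AE x in first_marginal (Suc m) \<mu>. emeasure (K x) B = emeasure (K\<^sub>0 x) B"
proof -
  let ?M = "first_marginal (Suc m) \<mu>"
  have sM: "sets ?M = sets (PiM {..<m} (\<lambda>_. borel))" by (simp add: first_marginal_def)
  interpret M: finite_measure ?M by (rule finite_measure_first_marginal)
  have Kd: "emeasure \<mu> {u \<in> space \<mu>. restrict u {..<m} \<in> A \<and> u m \<in> B} = (\<integral>\<^sup>+ x. indicator A x * emeasure (K x) B \<partial>?M)"
    if "A \<in> sets (PiM {..<m} (\<lambda>_. borel))" for A
    using K that B by (simp add: markov_kernel_of_def)
  have KB: "(\<lambda>x. emeasure (K x) B) \<in> borel_measurable (PiM {..<m} (\<lambda>_. borel))"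
    using K B by (simp add: markov_kernel_of_def)
  show ?thesis
  proof (rule M.density_unique_finite_measure)
    show "(\<lambda>x. emeasure (K x) B) \<in> borel_measurable ?M" "(\<lambda>x. emeasure (K\<^sub>0 x) B) \<in> borel_measurable ?M"
      using KB K0_measurable[OF B] by (simp_all add: measurable_cong_sets[OF sM refl])
    fix A assume "A \<in> sets ?M"
    then have A [measurable]: "A \<in> sets (PiM {..<m} (\<lambda>_. borel))" by (simp add: sM)
    have [measurable]: "B \<in> sets borel" by fact
    have "(\<integral>\<^sup>+x. indicator A x * emeasure (K x) B \<partial>?M)
        = (\<integral>\<^sup>+u. indicator A (restrict u {..<m}) * emeasure (K\<^sub>0 (restrict u {..<m})) B \<partial>\<mu>)"
      unfolding Kd[OF A, symmetric] by (rule K0_disintegration[OF A B])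
    also have "\<dots> = (\<integral>\<^sup>+x. indicator A x * emeasure (K\<^sub>0 x) B \<partial>?M)"
      unfolding first_marginal_def diff_Suc_1 by (subst nn_integral_distr) auto
    finally show "(\<integral>\<^sup>+x. emeasure (K x) B * indicator A x \<partial>?M) = (\<integral>\<^sup>+x. emeasure (K\<^sub>0 x) B * indicator A x \<partial>?M)"
      by (simp add: mult.commute)
  qed simp_all
qed

text \<open>Only countably many exceptional sets can be united, so B runs through the half-lines
  with rational end point. Right continuity extends the agreement to the whole distribution
  functions, so the two measures coincide.\<close>

lemma kernel_cont_strict_singular:
  assumes K: "markov_kernel_of (Suc m) \<mu> K"
  shows "AE x in first_marginal (Suc m) \<mu>. cont_strict_singular (\<lambda>y. measure (K x) {0..y})"
proof -
  have "AE x in first_marginal (Suc m) \<mu>. \<forall>q::rat. emeasure (K x) {..of_rat q} = emeasure (K\<^sub>0 x) {..of_rat q}"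
    unfolding AE_all_countable using kernel_eq_K0_AE[OF K] by simp
  moreover have "AE x in first_marginal (Suc m) \<mu>. x \<in> space (PiM {..<m} (\<lambda>_. borel))"
    by (rule AE_I2) (simp add: first_marginal_def)
  ultimately show ?thesis
  proof eventually_elim
    case (elim x)
    interpret Kx: real_distribution "K x"
      using K elim(2) by (intro real_distribution.intro real_distribution_axioms.intro)
        (auto simp: markov_kernel_of_def)
    interpret K0: real_distribution "K\<^sub>0 x"
      by (intro real_distribution.intro real_distribution_axioms.intro prob_space_K0) (simp add: K\<^sub>0_def)
    have "cdf (K x) = cdf (K\<^sub>0 x)"
      by (rule right_continuous_eq_rat)
        (use elim(1) Kx.cdf_is_right_cont K0.cdf_is_right_cont in \<open>auto simp: cdf_def measure_def\<close>)
    then have "K x = K\<^sub>0 x"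
      by (intro cdf_unique Kx.real_distribution_axioms K0.real_distribution_axioms)
    then show ?case by (simp add: cont_strict_singular_K0)
  qed
qed

end

theorem theorem6p1:
  fixes d :: nat
  assumes "d \<ge> 3"
  shows "\<exists>\<psi> \<mu>. arch_generator d \<psi> \<and> copula_measure d (arch_copula d \<psi>) \<mu> \<and>
     \<comment> \<open>(1)\<close>
     singular_wrt_lebesgue d \<mu> \<and>
     (\<forall>x \<in> space \<mu>. {x} \<in> sets \<mu> \<and> emeasure \<mu> {x} = 0) \<and>
     measure_support d \<mu> = unit_cube d \<and>
     \<comment> \<open>(2)\<close>
     (\<forall>K. markov_kernel_of d \<mu> K \<longrightarrow>
        (AE x in first_marginal d \<mu>. cont_strict_singular (\<lambda>y. measure (K x) {0..y}))) \<and>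
     \<comment> \<open>(3)\<close>
     (\<forall>t \<in> {0..1}. {u \<in> unit_cube d. arch_copula d \<psi> u = t} \<in> sets \<mu> \<and>
        emeasure \<mu> {u \<in> unit_cube d. arch_copula d \<psi> u = t} = 0) \<and>
     \<comment> \<open>(4)\<close>
     cont_strict_singular (kendall_df \<mu> (arch_copula d \<psi>))"
proof -
  define m where "m = d - 1"
  have d: "d = Suc m" and m: "2 \<le> m" using assms by (auto simp: m_def)
  obtain \<nu>0 N0 where "radial_measure \<nu>0 m N0" by (rule exists_radial_measure[OF m])
  then interpret R: radial_measure \<nu>0 m N0 .
  obtain \<nu> N where "normalized_radial_measure \<nu> m N" by (rule R.exists_normalized)
  then interpret normalized_radial_measure \<nu> m N .
  show ?thesis
    unfolding d
    by (intro exI[of _ \<psi>] exI[of _ \<mu>] conjI ballI allI impI arch_generator_psi copula_measure_mu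
        mu_singular mu_atomless mu_support kernel_cont_strict_singular cube_level_set_sets
        mu_level_set_null[OF cube_level_set_sets[unfolded sets_mu]] kendall_cont_strict_singular)
qed

end
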